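(* Assume: (i) $(X_t,y_t)_{t\ge1}$ are i.i.d. copies of $(X,y)\in\mathcal X\times\mathcal Y$, $\mathbb E[XX^T]$ is positive definite and $\|x\|\le D_X$ for all $x\in\mathcal X$; (ii) there is $\theta^*\in\mathbb R^d$ with $L(\theta^* )=\inf_{\theta\in\mathbb R^d}L(\theta)$; (iii) there exist $(\kappa_\varepsilon)_{\varepsilon>0}$, $(h_\varepsilon)_{\varepsilon>0}$ and $(\rho_\varepsilon)_{\varepsilon>0}$ with $\rho_\varepsilon\to1$ as $\varepsilon\to0$ such that for any $\varepsilon>0$ and any $\theta,\theta'\in\mathbb R^d$ with $\max(\|\theta-\theta^*\|,\|\theta'-\theta^*\|)\le\varepsilon$, almost surely $\ell'(y,\theta^TX)^2\le\kappa_\varepsilon\,\ell''(y,\theta^TX)$, $\ell''(y,\theta^TX)\le h_\varepsilon$ and $\ell''(y,\theta^TX)\ge\rho_\varepsilon\,\ell''(y,\theta'^TX)$; (iv) for any $\delta,\varepsilon>0$ there exists $\tau(\varepsilon,\delta)\in\mathbb N$ such that, with probability at least $1-\delta$, $\|\hat\theta_t-\theta^*\|\le\varepsilon$ holds simultaneously for all $t>\tau(\varepsilon,\delta)$, where $\hat\theta_t$ are the static EKF estimates. Let $\varepsilon>0$ be such that $\rho_\varepsilon>0.95$. Then for any $\delta>0$, with probability at least $1-3\delta$, it holds simultaneously for all $n\ge1$ that $$\sum_{t=\tau(\varepsilon,\delta)+1}^{\tau(\varepsilon,\delta)+n}\big(L(\hat\theta_t)-L(\theta^* )\big)\le\fr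ac52\,d\,\kappa_\varepsilon\ln\!\left(1+n\frac{h_\varepsilon\lambda_{\max}(P_1)D_X^2}{d}\right)+5\lambda_{\max}\!\left(P_{\tau(\varepsilon,\delta)+1}^{-1}\right)\varepsilon^2+30\left(2\kappa_\varepsilon+h_\varepsilon\varepsilon^2D_X^2\right)\ln\delta^{-1}.$$
   Context: Let $d\ge1$, $\mathcal X\subset\mathbb R^d$, $\mathcal Y\subset\mathbb R$; $\|\cdot\|$ is the Euclidean norm. The loss is the negative log-likelihood of a generalized linear model: $\ell(y,\theta^Tx)=-\log p_\theta(y\mid x)$ where $p_\theta(y\mid x)=h(y)\exp\left(\frac{y\,\theta^Tx-b(\theta^Tx)}{a}\right)$ with $a>0$ a constant and $h,b$ functions of one real variable, $b$ twice differentiable with $b''\ge0$. $\ell',\ell''$ denote derivatives with respect to the second argument: $\ell'(y,u)=(b'(u)-y)/a$, $\ell''(y,u)=b''(u)/a$. The data need not be generated by $p_\theta$. The risk is $L(\theta)=\mathbb E[\ell(y,\theta^TX)]$. Static Extended Kalman Filter (EKF): $P_1$ is any (deterministic) positive definite matrix and $\hat\theta_1\in\mathbb R^d$ any (deterministic) vector; for $t=1,2,\dots$, with $\alpha_t=b''(\hat\theta_t^TX_t)/a$, $$P_{t+1}=P_t-\frac{P_tX_tX_t^TP_t}{1+X_t^TP_tX_t\alpha_t}\alpha_t,\qquad \hat\theta_{t+1}=\hat\theta_t+P_{t+1}\frac{(y_t-b'(\hat\theta_t^TX_t))X_t}{a}.$$ $\lambda_{\max}$ denotes the largest eigenvalue.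 *)

theory Defs
  imports "HOL-Probability.Probability"
begin

definition glm_density :: "real \<Rightarrow> (real \<Rightarrow> real) \<Rightarrow> (real \<Rightarrow> real) \<Rightarrow> real \<Rightarrow> real \<Rightarrow> real" where
  "glm_density a h b y u = h y * exp ((y * u - b u) / a)"

text \<open>The second argument of the loss is the linear predictor \<open>u = \<theta> \<bullet> x\<close>.\<close>

definition glm_loss :: "real \<Rightarrow> (real \<Rightarrow> real) \<Rightarrow> (real \<Rightarrow> real) \<Rightarrow> real \<Rightarrow> real \<Rightarrow> real" where
  "glm_loss a h b y u = - ln (glm_density a h b y u)"

definition glm_loss' :: "real \<Rightarrow> (real \<Rightarrow> real) \<Rightarrow> (real \<Rightarrow> real) \<Rightarrow> real \<Rightarrow> real \<Rightarrow> real" where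
  "glm_loss' a h b y u = deriv (glm_loss a h b y) u"

definition glm_loss'' :: "real \<Rightarrow> (real \<Rightarrow> real) \<Rightarrow> (real \<Rightarrow> real) \<Rightarrow> real \<Rightarrow> real \<Rightarrow> real" where
  "glm_loss'' a h b y u = deriv (glm_loss' a h b y) u"

lemma glm_loss_eq:
  assumes "h y > 0"
  shows "glm_loss a h b y u = - ln (h y) - (y * u - b u) / a"
  using assms by (simp add: glm_loss_def glm_density_def ln_mult)

lemma glm_loss'_eq:
  assumes "a > 0" and "h y > 0" and "\<And>u. b differentiable (at u)"
  shows "glm_loss' a h b y u = (deriv b u - y) / a"
proof -
  have "(b has_real_derivative deriv b u) (at u)"
    using assms(3) by (simp add: DERIV_deriv_iff_real_differentiable)
  then have "((\<lambda>u. - ln (h y) - (y * u - b u) / a) has_real_derivative (deriv b u - y) / a) (at u)"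
    using assms(1) by (auto intro!: derivative_eq_intros simp: field_simps)
  moreover have "glm_loss a h b y = (\<lambda>u. - ln (h y) - (y * u - b u) / a)"
    using assms(2) by (simp add: fun_eq_iff glm_loss_eq)
  ultimately show ?thesis
    by (simp add: glm_loss'_def DERIV_imp_deriv)
qed

lemma glm_loss''_eq:
  assumes "a > 0" and "h y > 0" and "\<And>u. b differentiable (at u)" and "\<And>u. deriv b differentiable (at u)"
  shows "glm_loss'' a h b y u = deriv (deriv b) u / a"
proof -
  have "(deriv b has_real_derivative deriv (deriv b) u) (at u)"
    using assms(4) by (simp add: DERIV_deriv_iff_real_differentiable)
  then have "((\<lambda>u. (deriv b u - y) / a) has_real_derivative deriv (deriv b) u / a) (at u)"
    using assms(1) by (auto intro!: derivative_eq_intros)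
  moreover have "glm_loss' a h b y = (\<lambda>u. (deriv b u - y) / a)"
    using assms(1,2,3) by (simp add: fun_eq_iff glm_loss'_eq)
  ultimately show ?thesis
    by (simp add: glm_loss''_def DERIV_imp_deriv)
qed

definition glm_risk ::
  "'w measure \<Rightarrow> real \<Rightarrow> (real \<Rightarrow> real) \<Rightarrow> (real \<Rightarrow> real) \<Rightarrow>
   ('w \<Rightarrow> real ^ 'n) \<Rightarrow> ('w \<Rightarrow> real) \<Rightarrow> real ^ 'n \<Rightarrow> real" where
  "glm_risk M a h b X Y \<theta> = (LINT \<omega>|M. glm_loss a h b (Y \<omega>) (\<theta> \<bullet> X \<omega>))"

definition outer :: "real ^ 'n \<Rightarrow> real ^ 'm \<Rightarrow> real ^ 'm ^ 'n" where
  "outer v w = (\<chi> i j. v $ i * w $ j)"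

definition posdef :: "real ^ 'n ^ 'n \<Rightarrow> bool" where
  "posdef A \<longleftrightarrow> transpose A = A \<and> (\<forall>v. v \<noteq> 0 \<longrightarrow> v \<bullet> (A *v v) > 0)"

definition eigenval :: "real ^ 'n ^ 'n \<Rightarrow> real \<Rightarrow> bool" where
  "eigenval A k \<longleftrightarrow> (\<exists>v. v \<noteq> 0 \<and> A *v v = k *\<^sub>R v)"

text \<open>Only meaningful when a real eigenvalue exists; it is applied to symmetric matrices.\<close>

definition lambda_max :: "real ^ 'n ^ 'n \<Rightarrow> real" where
  "lambda_max A = (GREATEST k. eigenval A k)"

text \<open>
  \<open>static_ekf a b P1 \<theta>1 x y P \<theta>\<close> says that \<open>P\<close> and \<open>\<theta>\<close> are the static extended Kalman filter
  iterates on the data \<open>(x t, y t)\<close>. All sequences are indexed from 1; index 0 is unused.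
\<close>

definition static_ekf ::
  "real \<Rightarrow> (real \<Rightarrow> real) \<Rightarrow> real ^ 'n ^ 'n \<Rightarrow> real ^ 'n \<Rightarrow>
   (nat \<Rightarrow> real ^ 'n) \<Rightarrow> (nat \<Rightarrow> real) \<Rightarrow>
   (nat \<Rightarrow> real ^ 'n ^ 'n) \<Rightarrow> (nat \<Rightarrow> real ^ 'n) \<Rightarrow> bool" where
  "static_ekf a b P1 \<theta>1 x y P \<theta> \<longleftrightarrow>
     P 1 = P1 \<and> \<theta> 1 = \<theta>1 \<and>
     (\<forall>t\<ge>1. let \<alpha> = deriv (deriv b) (\<theta> t \<bullet> x t) / a in
        P (t + 1) = P t - (\<alpha> / (1 + (x t \<bullet> (P t *v x t)) * \<alpha>)) *\<^sub>R (P t ** outer (x t) (x t) ** P t) \<and>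
        \<theta> (t + 1) = \<theta> t + P (t + 1) *v (((y t - deriv b (\<theta> t \<bullet> x t)) / a) *\<^sub>R x t))"

end

theory Submission
  imports Defs
begin

text \<open>
  Write \<open>v = \<theta> t - \<theta>star\<close>, let \<open>g\<close> be the gradient of the loss at time \<open>t\<close> in the direction \<open>v\<close> and \<open>q\<close> its Hessian
  form at \<open>v\<close>. Since the inverse covariance grows by the Hessian at each step, the filter is an online
  Newton method: \<open>\<Sum> (g - q / 2)\<close> is at most half of the initial value of \<open>v \<bullet> (P\<inverse> v)\<close> plus \<open>\<kappa> / 2\<close> times a
  log-determinant, which the arithmetic-geometric mean inequality bounds by the logarithmic term.
  In a ball where the Hessian is nearly constant, Taylor expansion of the loss in both directions shows that
  the excess risk \<open>R\<close> satisfies \<open>\<rho> / 2 * E q \<le> R \<le> E g - \<rho> / 2 * E q\<close>. As \<open>\<rho> > 0.95\<close>, a fifth of \<open>R\<close> is below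
  \<open>E g - 2 / 3 * E q\<close>, and \<open>g\<^sup>2 \<le> \<kappa> * q\<close> makes \<open>exp (l * (R / 5 - g + q / 2))\<close> have mean at most \<open>1\<close> when
  \<open>1 / l = 6 * (2 * \<kappa> + H * \<epsilon>\<^sup>2 * D\<^sup>2)\<close>. Ville's inequality for the resulting supermartingale, in which only
  the times at which \<open>\<theta> t\<close> lies in the ball are counted, bounds \<open>\<Sum> (R / 5 - g + q / 2)\<close> uniformly in time.
\<close>

section \<open>Symmetric matrices\<close>

text \<open>Assumption (iii) holds almost surely only for each fixed parameter, with an exceptional
  set that may vary with it, whereas it is applied at the random \<open>\<theta> t\<close>. The
  filter is therefore rewritten as a recursion driven by the observations: its state is a function
  of earlier data, the joint law with the next observation is a product, and Fubini transfers almost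
  sure statements and exponential moments from a frozen state to the random one. This takes the
  place of conditional expectations. The event in (iv) looks at the whole future, so conditioning on
  it would destroy this independence; hence each increment is truncated by a condition on the
  current state alone, and the event is intersected only at the end. The coefficient 2/3 is 1/2,
  which offsets \<open>q / 2\<close> in the exponent, plus 1/6, which pays for the second moment;
  the 6 in \<open>1 / l\<close> is the reciprocal of that share. Keeping a fifth of the risk
  multiplies everything by 5, so 5/2 is 5 times the half in the regret bound and 30 is 5 times
  6.\<close>

definition diag_matrix :: "('n \<Rightarrow> real) \<Rightarrow> real ^ 'n ^ 'n" where
  "diag_matrix c = (\<chi> i j. if i = j then c i else 0)"

lemma inner_matrix_vector_sym:
  fixes A :: "real ^ 'n ^ 'n"
  assumes "transpose A = A"
  shows "u \<bullet> (A *v v) = (A *v u) \<bullet> v"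
  using dot_lmul_matrix[of u A v] assms by (metis transpose_matrix_vector)

lemma continuous_on_quadratic_form:
  fixes A :: "real ^ 'n ^ 'n"
  shows "continuous_on S (\<lambda>v. v \<bullet> (A *v v))"
  by (intro continuous_intros linear_continuous_on matrix_vector_mul_bounded_linear)

text \<open>Below, the form \<open>f u = k * (u \<bullet> u) - u \<bullet> (A *v u)\<close> is nonnegative and vanishes at the maximizer \<open>v\<close>,
  so it cannot decrease in the direction \<open>A *v v - k *\<^sub>R v\<close>.\<close>

lemma symmetric_rayleigh_max:
  fixes A :: "real ^ 'n ^ 'n"
  assumes sym: "transpose A = A" and S: "subspace S" and inv: "\<And>v. v \<in> S \<Longrightarrow> A *v v \<in> S"
    and nontriv: "\<exists>v\<in>S. v \<noteq> 0"
  shows "\<exists>v\<in>S. \<exists>k. norm v = 1 \<and> A *v v = k *\<^sub>R v \<and> (\<forall>u\<in>S. u \<bullet> (A *v u) \<le> k * (u \<bullet> u))"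
proof -
  let ?C = "S \<inter> sphere 0 1"
  obtain w where w: "w \<in> S" "w \<noteq> 0" using nontriv by blast
  have "compact ?C"
    using closed_subspace[OF S] by (simp add: closed_Int_compact)
  moreover have "w /\<^sub>R norm w \<in> ?C"
    using w S by (simp add: subspace_scale)
  ultimately obtain v where v: "v \<in> ?C" and max: "\<And>u. u \<in> ?C \<Longrightarrow> u \<bullet> (A *v u) \<le> v \<bullet> (A *v v)"
    using continuous_attains_sup[of ?C "\<lambda>v. v \<bullet> (A *v v)"] continuous_on_quadratic_form by blast
  define k where "k = v \<bullet> (A *v v)"
  have vS: "v \<in> S" and nv: "v \<bullet> v = 1" using v by (auto simp: dot_square_norm)
  define f where "f u = k * (u \<bullet> u) - u \<bullet> (A *v u)" for u
  have f_nonneg: "f u \<ge> 0" if "u \<in> S" for u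
  proof (cases "u = 0")
    case False
    have "u /\<^sub>R norm u \<in> ?C" using that False S by (simp add: subspace_scale)
    then have "(u /\<^sub>R norm u) \<bullet> (A *v (u /\<^sub>R norm u)) \<le> k" unfolding k_def by (rule max)
    then have "(u \<bullet> (A *v u)) / (norm u)\<^sup>2 \<le> k"
      by (simp add: matrix_vector_mult_scaleR power2_eq_square divide_inverse mult_ac)
    then show ?thesis using False by (simp add: f_def divide_le_eq dot_square_norm)
  qed (simp add: f_def)
  define w' where "w' = A *v v - k *\<^sub>R v"
  have w'S: "w' \<in> S" unfolding w'_def using vS inv S by (simp add: subspace_diff subspace_scale)
  have "w' = 0"
  proof (rule ccontr)
    assume "w' \<noteq> 0"
    then have pos: "w' \<bullet> w' > 0" by simp
    \<comment> \<open>The \<open>+ 1\<close> keeps the denominator positive when \<open>f w'\<close>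
      vanishes. With this \<open>t\<close> the quadratic term cancels at most half of the negative
      linear one.\<close>
    define t where "t = (w' \<bullet> w') / (f w' + 1)"
    have fw: "f w' \<ge> 0" using w'S by (rule f_nonneg)
    have t: "t > 0" unfolding t_def using pos fw by simp
    have "f (v + t *\<^sub>R w') = f v - 2 * t * (w' \<bullet> (A *v v) - k * (w' \<bullet> v)) + t\<^sup>2 * f w'"
      using inner_matrix_vector_sym[OF sym, of v w']
      by (simp add: f_def matrix_vector_right_distrib matrix_vector_mult_scaleR inner_add_left
          inner_add_right inner_commute algebra_simps power2_eq_square)
    also have "w' \<bullet> (A *v v) - k * (w' \<bullet> v) = w' \<bullet> w'"
      unfolding w'_def by (simp add: inner_diff_right inner_diff_left algebra_simps)
    also have "f v = 0" by (simp add: f_def nv k_def)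
    also have "0 - 2 * t * (w' \<bullet> w') + t\<^sup>2 * f w' = t * (t * f w' - 2 * (w' \<bullet> w'))"
      by (simp add: power2_eq_square algebra_simps)
    finally have "f (v + t *\<^sub>R w') = t * (t * f w' - 2 * (w' \<bullet> w'))" .
    moreover have "t * f w' \<le> w' \<bullet> w'"
      unfolding t_def using fw pos by (simp add: divide_le_eq algebra_simps)
    then have "t * (t * f w' - 2 * (w' \<bullet> w')) < 0"
      using t pos by (intro mult_pos_neg) linarith+
    moreover have "f (v + t *\<^sub>R w') \<ge> 0"
      using vS w'S S by (intro f_nonneg) (simp add: subspace_add subspace_scale)
    ultimately show False by simp
  qed
  then have "A *v v = k *\<^sub>R v" by (simp add: w'_def)
  moreover have "\<forall>u\<in>S. u \<bullet> (A *v u) \<le> k * (u \<bullet> u)" using f_nonneg by (simp add: f_def)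
  ultimately show ?thesis using vS v by auto
qed

text \<open>\<open>GREATEST\<close> yields something usable only once a greatest eigenvalue is
  exhibited. The maximizer of the quadratic form on the unit sphere supplies one, since every other
  eigenvalue is the Rayleigh quotient of its own eigenvector.\<close>

lemma lambda_max_rayleigh:
  fixes A :: "real ^ 'n ^ 'n"
  assumes sym: "transpose A = A"
  shows "eigenval A (lambda_max A)" and "u \<bullet> (A *v u) \<le> lambda_max A * (norm u)\<^sup>2"
proof -
  obtain v k where v: "norm v = 1" "A *v v = k *\<^sub>R v" and k: "\<And>u. u \<bullet> (A *v u) \<le> k * (u \<bullet> u)"
    using symmetric_rayleigh_max[OF sym, of UNIV] by (auto intro: exI[of _ 1])
  have ev: "eigenval A k" using v unfolding eigenval_def by (intro exI[of _ v]) auto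
  have "lambda_max A = k"
    unfolding lambda_max_def
  proof (rule Greatest_equality[where P = "eigenval A", OF ev])
    fix j assume "eigenval A j"
    then obtain w where "w \<noteq> 0" "A *v w = j *\<^sub>R w" by (auto simp: eigenval_def)
    then have "j * (w \<bullet> w) \<le> k * (w \<bullet> w)" using k[of w] by simp
    then show "j \<le> k" using \<open>w \<noteq> 0\<close> by (simp add: mult_le_cancel_right)
  qed
  then show "eigenval A (lambda_max A)" "u \<bullet> (A *v u) \<le> lambda_max A * (norm u)\<^sup>2"
    using ev k[of u] by (simp_all add: dot_square_norm)
qed

text \<open>Replaces a comparison with \<open>GREATEST\<close> by a family of inequalities without
  eigenvalues, the form in which measurability can be shown later.\<close>

lemma lambda_max_le_iff:
  fixes A :: "real ^ 'n ^ 'n"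
  assumes sym: "transpose A = A"
  shows "lambda_max A \<le> c \<longleftrightarrow> (\<forall>u. u \<bullet> (A *v u) \<le> c * (norm u)\<^sup>2)"
proof
  assume "lambda_max A \<le> c"
  then show "\<forall>u. u \<bullet> (A *v u) \<le> c * (norm u)\<^sup>2"
    using lambda_max_rayleigh(2)[OF sym] by (meson mult_right_mono order_trans zero_le_power2)
next
  assume *: "\<forall>u. u \<bullet> (A *v u) \<le> c * (norm u)\<^sup>2"
  obtain v where "v \<noteq> 0" "A *v v = lambda_max A *\<^sub>R v"
    using lambda_max_rayleigh(1)[OF sym] by (auto simp: eigenval_def)
  then have "lambda_max A * (v \<bullet> v) \<le> c * (v \<bullet> v)"
    using *[rule_format, of v] by (simp add: dot_square_norm)
  then show "lambda_max A \<le> c" using \<open>v \<noteq> 0\<close> by (simp add: mult_le_cancel_right)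
qed

text \<open>Take an orthonormal family of eigenvectors of maximal cardinality. If it were too small,
  its orthogonal complement would be a nontrivial invariant subspace, and maximizing the quadratic
  form there would give one more eigenvector.\<close>

lemma symmetric_eigenbasis:
  fixes A :: "real ^ 'n ^ 'n"
  assumes sym: "transpose A = A"
  shows "\<exists>B. pairwise orthogonal B \<and> (\<forall>v\<in>B. norm v = 1 \<and> (\<exists>k. A *v v = k *\<^sub>R v)) \<and> finite B \<and> card B = CARD('n)"
proof -
  define good where "good B \<longleftrightarrow> pairwise orthogonal B \<and>
    (\<forall>v\<in>B. norm v = 1 \<and> (\<exists>k. A *v v = k *\<^sub>R v))" for B
  have ind: "independent B" if "good B" for B
    using that unfolding good_def by (intro pairwise_orthogonal_independent) auto
  have fin: "finite B \<and> card B \<le> CARD('n)" if "good B" for B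
    using independent_bound[OF ind[OF that]] by simp
  have "good {}" by (simp add: good_def)
  then obtain B where B: "good B" and max: "\<And>C. good C \<Longrightarrow> card C \<le> card B"
    using ex_has_greatest_nat[of good "{}" card "Suc CARD('n)"] fin by (auto simp: less_Suc_eq_le)
  have "card B = CARD('n)"
  proof (rule ccontr)
    assume "card B \<noteq> CARD('n)"
    then have "card B < CARD('n)" using fin[OF B] by simp
    define S where "S = {v. \<forall>u\<in>B. orthogonal v u}"
    have S: "subspace S"
      unfolding S_def by (auto simp: subspace_def orthogonal_def inner_add_left)
    have "\<exists>v\<in>S. v \<noteq> 0"
    proof -
      have "dim (span B) < DIM(real^'n)"
        using \<open>card B < CARD('n)\<close> dim_eq_card_independent[OF ind[OF B]] by simp
      then have "span B \<noteq> UNIV" by (metis dim_UNIV less_irrefl)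
      then obtain a where "a \<noteq> 0" "\<And>x. x \<in> span B \<Longrightarrow> a \<bullet> x = 0"
        using span_not_UNIV_orthogonal[of B] by auto
      then show ?thesis by (auto simp: S_def orthogonal_def span_base intro!: exI[of _ a])
    qed
    moreover have "A *v v \<in> S" if "v \<in> S" for v
    proof -
      have "(A *v v) \<bullet> u = 0" if u: "u \<in> B" for u
      proof -
        obtain k where "A *v u = k *\<^sub>R u" using B u by (auto simp: good_def)
        then show ?thesis using inner_matrix_vector_sym[OF sym, of v u] \<open>v \<in> S\<close> u
          by (simp add: S_def orthogonal_def)
      qed
      then show ?thesis by (simp add: S_def orthogonal_def)
    qed
    ultimately obtain v k where v: "v \<in> S" "norm v = 1" "A *v v = k *\<^sub>R v"
      using symmetric_rayleigh_max[OF sym S] by blast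
    have "v \<notin> B" using v by (auto simp: S_def orthogonal_def)
    have "good (insert v B)"
      using B v unfolding good_def S_def
      by (auto simp: pairwise_insert orthogonal_commute)
    from max[OF this] show False using \<open>v \<notin> B\<close> fin[OF B] by simp
  qed
  then show ?thesis using B fin[OF B] by (auto simp: good_def)
qed

lemma spectral_decomposition:
  fixes A :: "real ^ 'n ^ 'n"
  assumes sym: "transpose A = A"
  shows "\<exists>Q c. orthogonal_matrix Q \<and> A = Q ** diag_matrix c ** transpose Q"
proof -
  obtain B where B: "pairwise orthogonal B" "\<And>v. v \<in> B \<Longrightarrow> norm v = 1"
      "\<And>v. v \<in> B \<Longrightarrow> \<exists>k. A *v v = k *\<^sub>R v" "finite B" "card B = CARD('n)"
    using symmetric_eigenbasis[OF sym] by blast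
  obtain q where q: "bij_betw q (UNIV :: 'n set) B"
    using finite_same_card_bij[of "UNIV :: 'n set" B] B by auto
  have qB: "q i \<in> B" for i using q by (auto simp: bij_betw_def)
  obtain c where c: "\<And>i. A *v q i = c i *\<^sub>R q i" using B(3)[OF qB] by metis
  define Q where "Q = transpose (\<chi> i. q i)"
  have col: "column i Q = q i" for i by (simp add: Q_def column_transpose row_def)
  have orth: "orthogonal_matrix Q"
    unfolding orthogonal_matrix_orthonormal_columns col
    using B q qB by (metis bij_betw_def injD pairwiseD)
  have "A ** Q = Q ** diag_matrix c"
  proof -
    have "(A ** Q) $ i $ j = (Q ** diag_matrix c) $ i $ j" for i j
    proof -
      have "(A ** Q) $ i $ j = (A *v column j Q) $ i"
        by (simp add: matrix_matrix_mult_def matrix_vector_mult_def column_def)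
      also have "\<dots> = c j * (Q $ i $ j)" by (simp add: col c) (simp add: Q_def transpose_def)
      also have "\<dots> = (Q ** diag_matrix c) $ i $ j"
        by (simp add: matrix_matrix_mult_def diag_matrix_def if_distrib cong: if_cong)
      finally show ?thesis .
    qed
    then show ?thesis by (simp add: vec_eq_iff)
  qed
  then have "A ** Q ** transpose Q = Q ** diag_matrix c ** transpose Q" by simp
  moreover have "A ** Q ** transpose Q = A"
    using orth by (simp add: orthogonal_matrix_def flip: matrix_mul_assoc)
  ultimately show ?thesis using orth by metis
qed

text \<open>Lets the sign of the entries of \<open>c\<close> be read off with
  \<open>posdef_eigenval_pos\<close>; the eigenvector is the column
  \<open>Q *v axis i 1\<close>.\<close>

lemma eigenval_diag:
  assumes A: "A = Q ** diag_matrix c ** transpose Q" and orth: "orthogonal_matrix Q"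
  shows "eigenval A (c i)"
proof -
  have QQ: "transpose Q ** Q = mat 1" using orth by (simp add: orthogonal_matrix_def)
  have "A ** Q = Q ** diag_matrix c"
    unfolding A by (simp add: QQ flip: matrix_mul_assoc)
  then have "A *v (Q *v axis i 1) = Q *v (diag_matrix c *v axis i 1)"
    by (simp add: matrix_vector_mul_assoc)
  also have "diag_matrix c *v axis i 1 = c i *\<^sub>R axis i 1"
    by (simp add: matrix_vector_mult_basis) (simp add: diag_matrix_def column_def vec_eq_iff axis_def)
  finally have "A *v (Q *v axis i 1) = c i *\<^sub>R (Q *v axis i 1)"
    by (simp add: matrix_vector_mult_scaleR)
  moreover have "Q *v axis i 1 \<noteq> 0"
  proof
    assume "Q *v axis i 1 = 0"
    then have "(transpose Q ** Q) *v axis i 1 = 0" by (simp flip: matrix_vector_mul_assoc)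
    then show False by (simp add: QQ axis_eq_0_iff)
  qed
  ultimately show ?thesis unfolding eigenval_def by blast
qed

lemma posdef_eigenval_pos:
  assumes "posdef A" "eigenval A k"
  shows "k > 0"
proof -
  obtain v where v: "v \<noteq> 0" "A *v v = k *\<^sub>R v" using assms by (auto simp: eigenval_def)
  then have "k * (v \<bullet> v) > 0" using assms by (metis inner_scaleR_right posdef_def)
  then show ?thesis using inner_ge_zero[of v] by (simp add: zero_less_mult_iff)
qed

lemma trace_diag_matrix: "trace (diag_matrix c) = (\<Sum>i\<in>UNIV. c i)"
  by (simp add: trace_def diag_matrix_def)

lemma det_diag_matrix: "det (diag_matrix c) = (\<Prod>i\<in>UNIV. c i)"
  by (subst det_diagonal) (auto simp: diag_matrix_def)

lemma transpose_diag_matrix: "transpose (diag_matrix c) = diag_matrix c"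
  by (simp add: diag_matrix_def transpose_def vec_eq_iff)

lemma diag_matrix_mult: "diag_matrix c ** diag_matrix d = diag_matrix (\<lambda>i. c i * d i)"
  by (simp add: diag_matrix_def matrix_matrix_mult_def vec_eq_iff mult_delta_left)

text \<open>Used for a change of coordinates in which a covariance matrix becomes the identity, so
  that rank-one updates can be computed there.\<close>

lemma posdef_factor:
  fixes A :: "real ^ 'n ^ 'n"
  assumes "posdef A"
  shows "\<exists>R :: real ^ 'n ^ 'n. A = R ** transpose R"
proof -
  obtain Q c where Q: "orthogonal_matrix Q" and A: "A = Q ** diag_matrix c ** transpose Q"
    using spectral_decomposition assms by (metis posdef_def)
  have c: "c i \<ge> 0" for i using posdef_eigenval_pos[OF assms eigenval_diag[OF A Q]] by (simp add: less_imp_le)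
  define S where "S = diag_matrix (\<lambda>i. sqrt (c i))"
  have "S ** transpose S = diag_matrix c"
    using c by (simp add: S_def diag_matrix_mult transpose_diag_matrix)
  then have "A = (Q ** S) ** transpose (Q ** S)"
    unfolding A by (metis matrix_mul_assoc matrix_transpose_mul)
  then show ?thesis by blast
qed

text \<open>Conjugation by an orthogonal matrix turns determinant and trace into product and sum of
  the positive numbers \<open>c i\<close>, so the last inequality is the one between their geometric
  and arithmetic means.\<close>

lemma posdef_det_le_trace:
  fixes A :: "real ^ 'n ^ 'n"
  assumes "posdef A"
  shows "0 < det A" "0 < trace A" "det A \<le> (trace A / CARD('n)) ^ CARD('n)"
proof -
  obtain Q c where Q: "orthogonal_matrix Q" and A: "A = Q ** diag_matrix c ** transpose Q"
    using spectral_decomposition assms by (metis posdef_def)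
  have c: "c i > 0" for i using posdef_eigenval_pos[OF assms eigenval_diag[OF A Q]] .
  have QQ: "transpose Q ** Q = mat 1" using Q by (simp add: orthogonal_matrix_def)
  have det: "det A = (\<Prod>i\<in>UNIV. c i)"
  proof -
    have "det A = det (diag_matrix c) * det (transpose Q ** Q)"
      unfolding A det_mul by simp
    then show ?thesis by (simp add: QQ det_diag_matrix)
  qed
  have "trace A = trace (transpose Q ** (Q ** diag_matrix c))"
    unfolding A by (rule trace_mul_sym)
  then have tr: "trace A = (\<Sum>i\<in>UNIV. c i)"
    by (simp add: matrix_mul_assoc QQ trace_diag_matrix)
  show "0 < det A" unfolding det using c by (intro prod_pos) auto
  show "0 < trace A" unfolding tr using c by (intro sum_pos) auto
  have "(\<Prod>i\<in>UNIV. c i) powr (1 / CARD('n)) \<le> (\<Sum>i\<in>UNIV. c i) / CARD('n)"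
    using arith_geom_mean[of "UNIV :: 'n set" c] c by (simp add: less_imp_le sum_divide_distrib)
  then have "((\<Prod>i\<in>UNIV. c i) powr (1 / CARD('n))) ^ CARD('n) \<le> ((\<Sum>i\<in>UNIV. c i) / CARD('n)) ^ CARD('n)"
    by (intro power_mono) auto
  moreover have "((\<Prod>i\<in>UNIV. c i) powr (1 / CARD('n))) ^ CARD('n) = (\<Prod>i\<in>UNIV. c i)"
    using prod_pos[of UNIV c] c
    by (subst powr_realpow[symmetric]) (auto simp: powr_powr simp del: prod_zero_iff)
  ultimately show "det A \<le> (trace A / CARD('n)) ^ CARD('n)"
    by (simp add: det tr)
qed

section \<open>Rank-one matrices and congruence\<close>

lemma outer_mult_vec: "outer u v *v w = (v \<bullet> w) *\<^sub>R u"
  by (simp add: outer_def matrix_vector_mult_def vec_eq_iff inner_vec_def sum_distrib_left mult_ac)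

lemma matrix_mult_outer: "(A :: real ^ 'n ^ 'm) ** outer u v = outer (A *v u) v"
  by (simp add: outer_def matrix_vector_mult_def matrix_matrix_mult_def vec_eq_iff
      sum_distrib_right mult.assoc)

lemma matrix_add_rdistrib: "((A :: real ^ 'n ^ 'm) + B) ** C = A ** C + B ** C"
  by (simp add: matrix_matrix_mult_def vec_eq_iff distrib_right sum.distrib)

lemma outer_mult_matrix: "outer u v ** (A :: real ^ 'n ^ 'm) = outer u (transpose A *v v)"
  by (simp add: outer_def matrix_vector_mult_def matrix_matrix_mult_def transpose_def vec_eq_iff
      sum_distrib_left mult_ac)

lemma trace_outer: "trace (outer u v) = u \<bullet> v"
  by (simp add: outer_def trace_def inner_vec_def)

text \<open>A rotation that carries a coordinate axis to the direction of \<open>y\<close> makes the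
  matrix diagonal with a single entry different from one.\<close>

lemma det_id_plus_outer:
  fixes y :: "real ^ 'n"
  shows "det (mat 1 + c *\<^sub>R outer y y) = 1 + c * (y \<bullet> y)"
proof -
  fix k :: 'n
  obtain f :: "real^'n \<Rightarrow> real^'n" where f: "orthogonal_transformation f" "f (norm y *\<^sub>R axis k 1) = y"
    using orthogonal_transformation_exists[of "norm y *\<^sub>R axis k 1" y] by (auto simp: norm_axis_1)
  define Q where "Q = matrix f"
  have Q: "orthogonal_matrix Q" using f by (simp add: Q_def orthogonal_transformation_matrix)
  have QQ: "Q ** transpose Q = mat 1" using Q by (simp add: orthogonal_matrix_def)
  have y: "y = Q *v (norm y *\<^sub>R axis k 1)"
    using f by (simp add: Q_def matrix_works orthogonal_transformation_linear)
  define d where "d = (\<lambda>i. if i = k then 1 + c * (y \<bullet> y) else 1)"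
  have D: "mat 1 + c *\<^sub>R outer (norm y *\<^sub>R axis k 1) (norm y *\<^sub>R axis k 1) = diag_matrix d"
    by (auto simp: diag_matrix_def d_def outer_def mat_def axis_def vec_eq_iff dot_square_norm power2_eq_square)
  have "outer y y = Q ** outer (norm y *\<^sub>R axis k 1) (norm y *\<^sub>R axis k 1) ** transpose Q"
    by (simp only: matrix_mult_outer outer_mult_matrix transpose_transpose y[symmetric])
  then have "Q ** (c *\<^sub>R outer (norm y *\<^sub>R axis k 1) (norm y *\<^sub>R axis k 1)) ** transpose Q = c *\<^sub>R outer y y"
    by (simp only: matrix_scalar_ac flip: scalar_matrix_assoc)
  then have "mat 1 + c *\<^sub>R outer y y = Q ** (diag_matrix d) ** transpose Q"
    by (simp only: D[symmetric] matrix_add_ldistrib matrix_add_rdistrib matrix_mul_rid QQ)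
  then have "det (mat 1 + c *\<^sub>R outer y y) = det (diag_matrix d) * det (Q ** transpose Q)"
    by (simp add: det_mul)
  then show ?thesis by (simp add: QQ det_diag_matrix d_def prod.delta)
qed

lemma posdef_congruence:
  fixes A R :: "real ^ 'n ^ 'n"
  assumes "posdef A" "invertible R"
  shows "posdef (transpose R ** A ** R)"
  unfolding posdef_def
proof (intro conjI allI impI)
  show "transpose (transpose R ** A ** R) = transpose R ** A ** R"
    using assms by (simp add: posdef_def matrix_transpose_mul matrix_mul_assoc)
  fix v :: "real ^ 'n" assume "v \<noteq> 0"
  obtain R' where R': "R' ** R = mat 1" using assms(2) by (auto simp: invertible_def)
  have "R' *v (R *v v) = v" by (simp add: matrix_vector_mul_assoc R')
  then have "R *v v \<noteq> 0" using \<open>v \<noteq> 0\<close> by auto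
  moreover have "v \<bullet> (transpose R *v w) = (R *v v) \<bullet> w" for w
    using dot_lmul_matrix[of v "transpose R" w] by simp
  then have "v \<bullet> ((transpose R ** A ** R) *v v) = (R *v v) \<bullet> (A *v (R *v v))"
    by (simp flip: matrix_vector_mul_assoc)
  ultimately show "v \<bullet> ((transpose R ** A ** R) *v v) > 0"
    using assms by (simp add: posdef_def)
qed

section \<open>Regret of the filter\<close>

lemma matrix_inv_inverse:
  fixes A :: "real ^ 'n ^ 'n"
  assumes "invertible A"
  shows "A ** matrix_inv A = mat 1" "matrix_inv A ** A = mat 1"
  using someI_ex[OF assms[unfolded invertible_def]] by (auto simp: matrix_inv_def)

lemma matrix_inv_eqI:
  fixes A B :: "real ^ 'n ^ 'n"
  assumes "A ** B = mat 1"
  shows "matrix_inv A = B"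
proof -
  have "B ** A = mat 1" using assms matrix_left_right_inverse by blast
  then have "invertible A" using assms by (auto simp: invertible_def)
  then have "matrix_inv A ** A = mat 1" by (rule matrix_inv_inverse)
  then have "matrix_inv A ** A ** B = B" by simp
  then show ?thesis by (simp add: assms flip: matrix_mul_assoc)
qed

lemma posdef_matrix_inv:
  fixes A :: "real ^ 'n ^ 'n"
  assumes A: "posdef A"
  shows "invertible A" "A ** matrix_inv A = mat 1" "matrix_inv A ** A = mat 1" "posdef (matrix_inv A)"
proof -
  show inv: "invertible A" using posdef_det_le_trace(1)[OF A] by (simp add: invertible_det_nz)
  then show r: "A ** matrix_inv A = mat 1" and l: "matrix_inv A ** A = mat 1"
    by (simp_all add: matrix_inv_inverse)
  show "posdef (matrix_inv A)"
    unfolding posdef_def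
  proof (intro conjI allI impI)
    have "transpose (matrix_inv A ** A) = mat 1" by (simp add: l)
    then have "A ** transpose (matrix_inv A) = mat 1"
      using A by (simp add: matrix_transpose_mul posdef_def)
    then show "transpose (matrix_inv A) = matrix_inv A" by (rule matrix_inv_eqI[symmetric])
    fix v :: "real ^ 'n" assume "v \<noteq> 0"
    define w where "w = matrix_inv A *v v"
    have v: "v = A *v w" by (simp add: w_def matrix_vector_mul_assoc r)
    then have "w \<noteq> 0" using \<open>v \<noteq> 0\<close> by auto
    then have "w \<bullet> (A *v w) > 0" using A by (simp add: posdef_def)
    then have "w \<bullet> v > 0" by (simp only: v[symmetric])
    then show "v \<bullet> (matrix_inv A *v v) > 0" by (simp only: w_def inner_commute)
  qed
qed

lemma posdef_nonneg: "posdef A \<Longrightarrow> v \<bullet> (A *v v) \<ge> 0"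
  by (cases "v = 0") (auto simp: posdef_def less_imp_le)

lemma posdef_rank_one_update:
  assumes "posdef A" "c \<ge> 0"
  shows "posdef (A + c *\<^sub>R outer x x)"
proof -
  have "transpose (A + c *\<^sub>R outer x x) = A + c *\<^sub>R outer x x"
    using assms by (simp add: posdef_def transpose_def vec_eq_iff outer_def mult.commute)
  moreover have "v \<bullet> ((A + c *\<^sub>R outer x x) *v v) > 0" if "v \<noteq> 0" for v
  proof -
    have "v \<bullet> ((A + c *\<^sub>R outer x x) *v v) = v \<bullet> (A *v v) + c * (x \<bullet> v)\<^sup>2"
      by (simp add: matrix_vector_mult_add_rdistrib inner_add_right outer_mult_vec power2_eq_square
          inner_commute flip: scaleR_matrix_vector_assoc)
    then show ?thesis using assms that by (simp add: posdef_def add_pos_nonneg)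
  qed
  ultimately show ?thesis by (simp add: posdef_def)
qed

text \<open>This is the Sherman-Morrison formula: the update of \<open>P\<close> is a rank-one
  increase of its inverse, and positive definiteness is inherited from that sum.\<close>

lemma ekf_covariance_step:
  fixes P :: "real ^ 'n ^ 'n"
  assumes P: "posdef P" and \<alpha>: "\<alpha> \<ge> 0"
    and P': "P' = P - (\<alpha> / (1 + (x \<bullet> (P *v x)) * \<alpha>)) *\<^sub>R (P ** outer x x ** P)"
  shows "posdef P'" "matrix_inv P' = matrix_inv P + \<alpha> *\<^sub>R outer x x"
    and "x \<bullet> (P' *v x) = (x \<bullet> (P *v x)) / (1 + (x \<bullet> (P *v x)) * \<alpha>)"
    and "u \<bullet> (P' *v u) \<le> u \<bullet> (P *v u)"
proof -
  define q where "q = x \<bullet> (P *v x)"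
  define c where "c = \<alpha> / (1 + q * \<alpha>)"
  have q: "q \<ge> 0" unfolding q_def using P by (rule posdef_nonneg)
  then have q1: "1 + q * \<alpha> > 0" using \<alpha> by (simp add: add_pos_nonneg)
  have c: "c \<ge> 0" unfolding c_def using q1 \<alpha> by simp
  have symP: "transpose P = P" using P by (simp add: posdef_def)
  have P': "P' = P - c *\<^sub>R outer (P *v x) (P *v x)"
    unfolding P' c_def q_def by (simp add: matrix_mult_outer outer_mult_matrix symP)
  have P'_mult: "P' *v u = P *v u - (c * (x \<bullet> (P *v u))) *\<^sub>R (P *v x)" for u
    unfolding P' using inner_matrix_vector_sym[OF symP, of x u]
    by (simp add: matrix_vector_mult_diff_rdistrib outer_mult_vec flip: scaleR_matrix_vector_assoc)
  define A where "A = matrix_inv P + \<alpha> *\<^sub>R outer x x"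
  have A: "posdef A" unfolding A_def using P \<alpha> by (intro posdef_rank_one_update posdef_matrix_inv)
  \<comment> \<open>Writing \<open>w = P *v z\<close> avoids products of inverses; the two multiples
    of \<open>P *v x\<close> cancel by the choice of \<open>c\<close>.\<close>
  have "P' *v (A *v w) = w" for w
  proof -
    define z where "z = matrix_inv P *v w"
    have Pz: "P *v z = w" by (simp add: z_def matrix_vector_mul_assoc posdef_matrix_inv(2)[OF P])
    have Aw: "A *v w = z + (\<alpha> * (x \<bullet> w)) *\<^sub>R x"
      unfolding A_def by (simp add: matrix_vector_mult_add_rdistrib outer_mult_vec z_def
          flip: scaleR_matrix_vector_assoc)
    have "P' *v (A *v w) = w + (\<alpha> * (x \<bullet> w)) *\<^sub>R (P *v x)
        - (c * (x \<bullet> w + \<alpha> * (x \<bullet> w) * q)) *\<^sub>R (P *v x)"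
      unfolding P'_mult Aw
      by (simp add: matrix_vector_right_distrib matrix_vector_mult_scaleR Pz inner_add_right q_def)
    also have "c * (x \<bullet> w + \<alpha> * (x \<bullet> w) * q) = \<alpha> * (x \<bullet> w)"
      unfolding c_def using q1 by (simp add: field_simps)
    finally show ?thesis by simp
  qed
  then have "(P' ** A) *v w = mat 1 *v w" for w
    by (simp flip: matrix_vector_mul_assoc)
  then have P'A: "P' ** A = mat 1" by (metis matrix_eq)
  then have "A ** P' = mat 1" using matrix_left_right_inverse by blast
  then have "P' = matrix_inv A" by (rule matrix_inv_eqI[symmetric])
  then show "posdef P'" using posdef_matrix_inv(4)[OF A] by simp
  show "matrix_inv P' = matrix_inv P + \<alpha> *\<^sub>R outer x x"
    using matrix_inv_eqI[OF P'A] by (simp only: A_def)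
  have "x \<bullet> (P' *v x) = q - c * q\<^sup>2"
    unfolding P'_mult by (simp add: inner_diff_right q_def power2_eq_square)
  also have "\<dots> = q / (1 + q * \<alpha>)"
    unfolding c_def using q1 by (simp add: field_simps power2_eq_square)
  finally show "x \<bullet> (P' *v x) = (x \<bullet> (P *v x)) / (1 + (x \<bullet> (P *v x)) * \<alpha>)"
    by (simp add: q_def)
  have "u \<bullet> (P' *v u) = u \<bullet> (P *v u) - c * (x \<bullet> (P *v u))\<^sup>2"
    unfolding P'_mult using inner_matrix_vector_sym[OF symP, of x u]
    by (simp add: inner_diff_right power2_eq_square inner_commute)
  then show "u \<bullet> (P' *v u) \<le> u \<bullet> (P *v u)" using c by simp
qed

lemma posdef_factor_inverse:
  fixes P R :: "real ^ 'n ^ 'n"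
  assumes P: "posdef P" and R: "P = R ** transpose R"
  shows "invertible R" "transpose R ** matrix_inv P ** R = mat 1"
proof -
  have "det P \<noteq> 0" using posdef_det_le_trace(1)[OF P] by simp
  then show inv: "invertible R" unfolding R by (simp add: det_mul invertible_det_nz)
  then obtain R' where R': "R' ** R = mat 1" by (auto simp: invertible_def)
  have "R ** (transpose R ** matrix_inv P ** R) = P ** matrix_inv P ** R"
    by (simp add: matrix_mul_assoc flip: R)
  then have "R ** (transpose R ** matrix_inv P ** R) = R"
    by (simp add: posdef_matrix_inv(2)[OF P])
  then show "transpose R ** matrix_inv P ** R = mat 1"
    by (metis R' matrix_mul_assoc matrix_mul_lid)
qed

lemma inner_gram:
  fixes R :: "real ^ 'n ^ 'n"
  shows "(transpose R *v u) \<bullet> (transpose R *v u) = u \<bullet> ((R ** transpose R) *v u)"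
proof -
  have "(R ** transpose R) *v u = R *v (transpose R *v u)"
    by (simp only: matrix_vector_mul_assoc)
  then show ?thesis
    using dot_lmul_matrix[of u R "transpose R *v u"] by (simp only: transpose_matrix_vector)
qed

lemma congruence_rank_one_update:
  fixes A R :: "real ^ 'n ^ 'n"
  shows "transpose R ** (A + c *\<^sub>R outer x x) ** R
       = transpose R ** A ** R + c *\<^sub>R outer (transpose R *v x) (transpose R *v x)"
proof -
  have "transpose R ** (c *\<^sub>R outer x x) ** R = c *\<^sub>R (transpose R ** outer x x ** R)"
    by (simp only: matrix_scalar_ac flip: scalar_matrix_assoc)
  also have "transpose R ** outer x x ** R = outer (transpose R *v x) (transpose R *v x)"
    by (simp only: matrix_mult_outer outer_mult_matrix)
  finally show ?thesis by (simp only: matrix_add_ldistrib matrix_add_rdistrib)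
qed

text \<open>The matrix determinant lemma. Congruence by a factor \<open>R\<close> of
  \<open>P\<close> multiplies the determinant by \<open>det P\<close> and reduces the update to one
  of the identity.\<close>

lemma det_inverse_rank_one_update:
  fixes P :: "real ^ 'n ^ 'n"
  assumes P: "posdef P"
  shows "det (matrix_inv P + c *\<^sub>R outer x x) = det (matrix_inv P) * (1 + c * (x \<bullet> (P *v x)))"
proof -
  obtain R :: "real ^ 'n ^ 'n" where R: "P = R ** transpose R" using posdef_factor[OF P] by blast
  have "det P * det (matrix_inv P + c *\<^sub>R outer x x)
      = det (transpose R ** (matrix_inv P + c *\<^sub>R outer x x) ** R)"
    by (simp add: R det_mul)
  also have "\<dots> = 1 + c * ((transpose R *v x) \<bullet> (transpose R *v x))"
    by (simp only: congruence_rank_one_update posdef_factor_inverse(2)[OF P R] det_id_plus_outer)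
  also have "(transpose R *v x) \<bullet> (transpose R *v x) = x \<bullet> (P *v x)"
    unfolding R by (rule inner_gram)
  finally have "det P * det (matrix_inv P + c *\<^sub>R outer x x) = 1 + c * (x \<bullet> (P *v x))" .
  moreover have "det (matrix_inv P) * det P = 1"
    using posdef_matrix_inv(3)[OF P] by (simp flip: det_mul)
  then have "det (matrix_inv P + c *\<^sub>R outer x x)
      = det (matrix_inv P) * (det P * det (matrix_inv P + c *\<^sub>R outer x x))"
    by (simp flip: mult.assoc)
  ultimately show ?thesis by simp
qed

text \<open>The elliptical potential bound. In the coordinates of a factor \<open>R\<close> of
  \<open>P m\<close> the inverse covariances become matrices \<open>B j\<close> starting at the
  identity. The factors on the left telescope to \<open>det (B n)\<close>, while each update raises
  the trace by a form in the fixed matrix \<open>P m\<close>; determinant and trace are then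
  compared.\<close>

lemma sum_ln_rank_one_updates_le:
  fixes P :: "nat \<Rightarrow> real ^ 'n ^ 'n" and x :: "nat \<Rightarrow> real ^ 'n"
  assumes P: "\<And>t. t \<ge> m \<Longrightarrow> posdef (P t)" and \<alpha>: "\<And>t. t \<ge> m \<Longrightarrow> \<alpha> t \<ge> 0"
    and step: "\<And>t. t \<ge> m \<Longrightarrow> matrix_inv (P (Suc t)) = matrix_inv (P t) + \<alpha> t *\<^sub>R outer (x t) (x t)"
  shows "(\<Sum>t\<in>{m..<m+n}. ln (1 + \<alpha> t * (x t \<bullet> (P t *v x t))))
     \<le> CARD('n) * ln (1 + (\<Sum>t\<in>{m..<m+n}. \<alpha> t * (x t \<bullet> (P m *v x t))) / CARD('n))"
proof -
  obtain R :: "real ^ 'n ^ 'n" where R: "P m = R ** transpose R" using posdef_factor[OF P[OF order.refl]] by blast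
  note Rm = posdef_factor_inverse[OF P[OF order.refl] R]
  define B where "B j = transpose R ** matrix_inv (P (m + j)) ** R" for j
  have Bstep: "B (Suc j) = B j + \<alpha> (m+j) *\<^sub>R outer (transpose R *v x (m+j)) (transpose R *v x (m+j))" for j
    using step[of "m+j"] by (simp add: B_def congruence_rank_one_update)
  have q: "(transpose R *v u) \<bullet> (transpose R *v u) = u \<bullet> (P m *v u)" for u
    unfolding R by (rule inner_gram)
  have fac: "1 + \<alpha> t * (x t \<bullet> (P t *v x t)) > 0" if "t \<ge> m" for t
    using \<alpha>[OF that] posdef_nonneg[OF P[OF that]] by (simp add: add_pos_nonneg)
  have pd: "posdef (B n)" unfolding B_def
    by (intro posdef_congruence posdef_matrix_inv P Rm) simp
  have tr: "trace (B j) = CARD('n) + (\<Sum>t\<in>{m..<m+j}. \<alpha> t * (x t \<bullet> (P m *v x t)))" for j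
  proof (induction j)
    case 0
    show ?case by (simp add: B_def Rm(2) trace_I)
  next
    case (Suc j)
    have "trace (c *\<^sub>R M) = c * trace M" for c and M :: "real ^ 'n ^ 'n"
      by (simp add: trace_def sum_distrib_left)
    then show ?case using Suc by (simp add: Bstep trace_add trace_outer q del: transpose_matrix_vector)
  qed
  have "det (B j) = (\<Prod>t\<in>{m..<m+j}. 1 + \<alpha> t * (x t \<bullet> (P t *v x t)))" for j
  proof (induction j)
    case 0
    show ?case by (simp add: B_def Rm(2))
  next
    case (Suc j)
    have "det (B (Suc j)) = det R * det (matrix_inv (P (Suc (m + j)))) * det R"
      by (simp add: B_def det_mul)
    also have "\<dots> = det (B j) * (1 + \<alpha> (m+j) * (x (m+j) \<bullet> (P (m+j) *v x (m+j))))"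
      using step[of "m+j"] det_inverse_rank_one_update[OF P[of "m+j"]] by (simp add: B_def det_mul)
    finally show ?case using Suc by simp
  qed
  then have "(\<Sum>t\<in>{m..<m+n}. ln (1 + \<alpha> t * (x t \<bullet> (P t *v x t)))) = ln (det (B n))"
    using fac by (subst ln_prod[symmetric]) (auto simp: less_le)
  also have "ln (det (B n)) \<le> ln ((trace (B n) / CARD('n)) ^ CARD('n))"
    using posdef_det_le_trace[OF pd] by (intro ln_mono) auto
  also have "\<dots> = CARD('n) * ln (trace (B n) / CARD('n))"
    by (simp add: ln_realpow)
  also have "trace (B n) / CARD('n) = 1 + (\<Sum>t\<in>{m..<m+n}. \<alpha> t * (x t \<bullet> (P m *v x t))) / CARD('n)"
    by (simp add: tr add_divide_distrib)
  finally show ?thesis .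
qed

text \<open>The covariance only decreases, so \<open>lambda_max P1\<close> controls the quadratic
  forms from any later starting time. The induction runs over \<open>Suc n\<close> because the
  filter starts at index 1.\<close>

lemma static_ekf_covariance:
  fixes P :: "nat \<Rightarrow> real ^ 'n ^ 'n"
  assumes ekf: "static_ekf a b P1 \<theta>1 x y P \<theta>" and P1: "posdef P1"
    and a: "a > 0" and b: "\<And>u. deriv (deriv b) u \<ge> 0" and t: "t \<ge> 1"
  shows "posdef (P t)" "u \<bullet> (P t *v u) \<le> u \<bullet> (P1 *v u)"
proof -
  have "posdef (P (Suc n)) \<and> (\<forall>u. u \<bullet> (P (Suc n) *v u) \<le> u \<bullet> (P1 *v u))" for n
  proof (induction n)
    case 0
    then show ?case using ekf P1 by (simp add: static_ekf_def)
  next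
    case (Suc n)
    define \<alpha> where "\<alpha> = deriv (deriv b) (\<theta> (Suc n) \<bullet> x (Suc n)) / a"
    have "\<alpha> \<ge> 0" using a b by (simp add: \<alpha>_def)
    moreover have "P (Suc (Suc n)) = P (Suc n) - (\<alpha> / (1 + (x (Suc n) \<bullet> (P (Suc n) *v x (Suc n))) * \<alpha>))
        *\<^sub>R (P (Suc n) ** outer (x (Suc n)) (x (Suc n)) ** P (Suc n))"
      using ekf by (auto simp: static_ekf_def Let_def \<alpha>_def)
    ultimately show ?case
      using Suc ekf_covariance_step(1,4)[of "P (Suc n)" \<alpha>] by (meson order_trans)
  qed
  from this[of "t - 1"] t show "posdef (P t)" "u \<bullet> (P t *v u) \<le> u \<bullet> (P1 *v u)" by auto
qed

text \<open>Online Newton step analysis, with the Lyapunov function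
  \<open>(\<theta> t - \<phi>) \<bullet> (matrix_inv (P t) *v (\<theta> t - \<phi>))\<close>.\<close>

lemma static_ekf_regret:
  fixes P :: "nat \<Rightarrow> real ^ 'n ^ 'n" and x \<theta> :: "nat \<Rightarrow> real ^ 'n" and \<kappa> :: real
  assumes ekf: "static_ekf a b P1 \<theta>1 x y P \<theta>" and P1: "posdef P1"
    and a: "a > 0" and b: "\<And>u. deriv (deriv b) u \<ge> 0" and m: "m \<ge> 1" and \<kappa>: "\<kappa> \<ge> 0"
    and D: "\<And>t. t \<ge> m \<Longrightarrow> norm (x t) \<le> D"
    and H: "\<And>t. t \<ge> m \<Longrightarrow> deriv (deriv b) (\<theta> t \<bullet> x t) / a \<le> H"
    and g: "\<And>t. t \<ge> m \<Longrightarrow> ((deriv b (\<theta> t \<bullet> x t) - y t) / a)\<^sup>2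
                          \<le> \<kappa> * (deriv (deriv b) (\<theta> t \<bullet> x t) / a)"
    and \<epsilon>: "norm (\<theta> m - \<phi>) \<le> \<epsilon>"
  shows "(\<Sum>t\<in>{m..<m+n}. (deriv b (\<theta> t \<bullet> x t) - y t) / a * ((\<theta> t - \<phi>) \<bullet> x t)
            - deriv (deriv b) (\<theta> t \<bullet> x t) / a * ((\<theta> t - \<phi>) \<bullet> x t)\<^sup>2 / 2)
    \<le> lambda_max (matrix_inv (P m)) * \<epsilon>\<^sup>2 / 2
      + CARD('n) * \<kappa> * ln (1 + n * (H * lambda_max P1 * D\<^sup>2 / CARD('n))) / 2"
proof -
  define \<alpha> where "\<alpha> t = deriv (deriv b) (\<theta> t \<bullet> x t) / a" for t
  define l where "l t = (deriv b (\<theta> t \<bullet> x t) - y t) / a" for t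
  define v where "v t = \<theta> t - \<phi>" for t
  define q where "q t = x t \<bullet> (P t *v x t)" for t
  define V where "V t = v t \<bullet> (matrix_inv (P t) *v v t)" for t
  have pd: "posdef (P t)" if "t \<ge> m" for t
    using static_ekf_covariance[OF ekf P1 a b] m that by auto
  have \<alpha>0: "\<alpha> t \<ge> 0" for t using a b by (simp add: \<alpha>_def)
  have q0: "q t \<ge> 0" if "t \<ge> m" for t unfolding q_def using pd[OF that] by (rule posdef_nonneg)
  have V0: "V t \<ge> 0" if "t \<ge> m" for t
    unfolding V_def by (intro posdef_nonneg posdef_matrix_inv pd that)
  have Pstep: "P (Suc t) = P t - (\<alpha> t / (1 + (x t \<bullet> (P t *v x t)) * \<alpha> t)) *\<^sub>R (P t ** outer (x t) (x t) ** P t)"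
    and \<theta>step: "\<theta> (Suc t) = \<theta> t - l t *\<^sub>R (P (Suc t) *v x t)" if "t \<ge> m" for t
  proof -
    have "(y t - deriv b (\<theta> t \<bullet> x t)) / a = - l t" by (simp add: l_def minus_divide_left)
    then show "P (Suc t) = P t - (\<alpha> t / (1 + (x t \<bullet> (P t *v x t)) * \<alpha> t)) *\<^sub>R (P t ** outer (x t) (x t) ** P t)"
      "\<theta> (Suc t) = \<theta> t - l t *\<^sub>R (P (Suc t) *v x t)"
      using ekf that m by (auto simp: static_ekf_def Let_def \<alpha>_def matrix_vector_mult_scaleR)
  qed
  note step = ekf_covariance_step[OF pd \<alpha>0 Pstep]
  have main: "2 * (l t * (v t \<bullet> x t)) - \<alpha> t * (v t \<bullet> x t)\<^sup>2 \<le> V t - V (Suc t) + \<kappa> * ln (1 + \<alpha> t * q t)"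
    if t: "t \<ge> m" for t
  proof -
    define A' where "A' = matrix_inv (P (Suc t))"
    define w where "w = P (Suc t) *v x t"
    have pd': "posdef (P (Suc t))" using pd t by simp
    have Aw: "A' *v w = x t"
      by (simp add: A'_def w_def matrix_vector_mul_assoc posdef_matrix_inv(3)[OF pd'])
    have symA: "transpose A' = A'"
      unfolding A'_def using posdef_matrix_inv(4)[OF pd'] by (simp add: posdef_def)
    have v': "v (Suc t) = v t - l t *\<^sub>R w" by (simp add: v_def \<theta>step[OF t] w_def)
    have "V (Suc t) = v t \<bullet> (A' *v v t) - 2 * (l t * (v t \<bullet> x t)) + (l t)\<^sup>2 * (x t \<bullet> w)"
      unfolding V_def v' A'_def[symmetric] using inner_matrix_vector_sym[OF symA, of w "v t"]
      by (simp add: matrix_vector_mult_diff_distrib matrix_vector_mult_scaleR Aw inner_diff_left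
          inner_diff_right inner_commute power2_eq_square algebra_simps)
    \<comment> \<open>The new inverse covariance exceeds the old one by the Hessian of the current
      loss; this is the source of the negative quadratic term in \<open>main\<close>.\<close>
    moreover have "v t \<bullet> (A' *v v t) = V t + \<alpha> t * (v t \<bullet> x t)\<^sup>2"
      unfolding A'_def step(2)[OF t t] V_def
      by (simp add: matrix_vector_mult_add_rdistrib outer_mult_vec inner_add_right power2_eq_square
          inner_commute flip: scaleR_matrix_vector_assoc)
    moreover have "(l t)\<^sup>2 * (x t \<bullet> w) \<le> \<kappa> * ln (1 + \<alpha> t * q t)"
    proof -
      have pos: "1 + \<alpha> t * q t > 0" using \<alpha>0 q0[OF t] by (simp add: add_pos_nonneg)
      have "0 \<le> \<kappa> * \<alpha> t" using \<kappa> \<alpha>0[of t] by simp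
      then have "(l t)\<^sup>2 * (x t \<bullet> w) \<le> \<kappa> * \<alpha> t * (q t / (1 + \<alpha> t * q t))"
        using g[OF t] q0[OF t] pos step(3)[OF t t]
        by (intro mult_mono) (auto simp: l_def \<alpha>_def w_def q_def mult.commute)
      also have "\<alpha> t * (q t / (1 + \<alpha> t * q t)) = 1 - inverse (1 + \<alpha> t * q t)"
        using pos by (simp add: field_simps)
      then have "\<kappa> * \<alpha> t * (q t / (1 + \<alpha> t * q t)) = \<kappa> * (1 - inverse (1 + \<alpha> t * q t))"
        by (simp only: mult.assoc)
      also have "\<dots> \<le> \<kappa> * ln (1 + \<alpha> t * q t)"
        using ln_le_minus_one[of "inverse (1 + \<alpha> t * q t)"] pos \<kappa>
        by (intro mult_left_mono) (auto simp: ln_inverse)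
      finally show ?thesis .
    qed
    ultimately show ?thesis by simp
  qed
  have "(\<Sum>t\<in>{m..<m+n}. 2 * (l t * (v t \<bullet> x t)) - \<alpha> t * (v t \<bullet> x t)\<^sup>2)
      \<le> (\<Sum>t\<in>{m..<m+n}. V t - V (Suc t) + \<kappa> * ln (1 + \<alpha> t * q t))"
    by (intro sum_mono main) simp
  also have "\<dots> = V m - V (m + n) + \<kappa> * (\<Sum>t\<in>{m..<m+n}. ln (1 + \<alpha> t * q t))"
  proof -
    have "(\<Sum>t\<in>{m..<m+n}. V t - V (Suc t)) = V m - V (m + n)"
      by (induction n) auto
    then show ?thesis by (simp add: sum.distrib sum_distrib_left)
  qed
  also have "\<dots> \<le> lambda_max (matrix_inv (P m)) * \<epsilon>\<^sup>2
      + \<kappa> * (CARD('n) * ln (1 + n * (H * lambda_max P1 * D\<^sup>2 / CARD('n))))"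
  proof -
    have pdi: "posdef (matrix_inv (P m))" using pd by (intro posdef_matrix_inv) simp
    have "V m \<le> lambda_max (matrix_inv (P m)) * (norm (v m))\<^sup>2"
      unfolding V_def using pdi by (intro lambda_max_rayleigh) (simp add: posdef_def)
    also have "\<dots> \<le> lambda_max (matrix_inv (P m)) * \<epsilon>\<^sup>2"
    proof (intro mult_left_mono power_mono)
      show "0 \<le> lambda_max (matrix_inv (P m))"
        using posdef_eigenval_pos[OF pdi] lambda_max_rayleigh(1) pdi by (metis less_imp_le posdef_def)
    qed (use \<epsilon> in \<open>auto simp: v_def\<close>)
    finally have "V m \<le> lambda_max (matrix_inv (P m)) * \<epsilon>\<^sup>2" .
    moreover have "(\<Sum>t\<in>{m..<m+n}. ln (1 + \<alpha> t * q t))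
        \<le> CARD('n) * ln (1 + (\<Sum>t\<in>{m..<m+n}. \<alpha> t * (x t \<bullet> (P m *v x t))) / CARD('n))"
      unfolding q_def using pd \<alpha>0 step(2) by (intro sum_ln_rank_one_updates_le) auto
    moreover have "CARD('n) * ln (1 + (\<Sum>t\<in>{m..<m+n}. \<alpha> t * (x t \<bullet> (P m *v x t))) / CARD('n))
        \<le> CARD('n) * ln (1 + n * (H * lambda_max P1 * D\<^sup>2 / CARD('n)))"
    proof -
      have term0: "0 \<le> \<alpha> t * (x t \<bullet> (P m *v x t))" for t
        by (intro mult_nonneg_nonneg \<alpha>0 posdef_nonneg pd) simp
      have "\<alpha> t * (x t \<bullet> (P m *v x t)) \<le> H * (lambda_max P1 * D\<^sup>2)" if t: "t \<ge> m" for t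
      proof (rule mult_mono)
        have symP1: "transpose P1 = P1" using P1 by (simp add: posdef_def)
        have "x t \<bullet> (P m *v x t) \<le> x t \<bullet> (P1 *v x t)"
          using static_ekf_covariance[OF ekf P1 a b] m by auto
        also have "\<dots> \<le> lambda_max P1 * (norm (x t))\<^sup>2" by (rule lambda_max_rayleigh[OF symP1])
        also have "\<dots> \<le> lambda_max P1 * D\<^sup>2"
          using posdef_eigenval_pos[OF P1 lambda_max_rayleigh(1)[OF symP1]] D[OF t]
          by (intro mult_left_mono power_mono) auto
        finally show "x t \<bullet> (P m *v x t) \<le> lambda_max P1 * D\<^sup>2" .
        show "\<alpha> t \<le> H" using H[OF t] by (simp add: \<alpha>_def)
        show "0 \<le> H" using H[OF t] \<alpha>0[of t] by (simp add: \<alpha>_def)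
        show "0 \<le> x t \<bullet> (P m *v x t)" by (intro posdef_nonneg pd) simp
      qed
      then have "(\<Sum>t\<in>{m..<m+n}. \<alpha> t * (x t \<bullet> (P m *v x t))) \<le> (\<Sum>t\<in>{m..<m+n}. H * (lambda_max P1 * D\<^sup>2))"
        by (intro sum_mono) simp
      then have "(\<Sum>t\<in>{m..<m+n}. \<alpha> t * (x t \<bullet> (P m *v x t))) / CARD('n)
          \<le> n * (H * lambda_max P1 * D\<^sup>2 / CARD('n))"
        by (simp add: divide_right_mono mult.assoc)
      moreover have "0 \<le> (\<Sum>t\<in>{m..<m+n}. \<alpha> t * (x t \<bullet> (P m *v x t))) / CARD('n)"
        using term0 by (intro divide_nonneg_nonneg sum_nonneg) auto
      ultimately show ?thesis by (intro mult_left_mono ln_mono) auto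
    qed
    ultimately show ?thesis using V0[of "m+n"] \<kappa> by (smt (verit) le_add1 mult_left_mono)
  qed
  finally have "(\<Sum>t\<in>{m..<m+n}. 2 * (l t * (v t \<bullet> x t)) - \<alpha> t * (v t \<bullet> x t)\<^sup>2) / 2
     \<le> (lambda_max (matrix_inv (P m)) * \<epsilon>\<^sup>2
      + \<kappa> * (CARD('n) * ln (1 + n * (H * lambda_max P1 * D\<^sup>2 / CARD('n))))) / 2"
    by (rule divide_right_mono) simp
  then show ?thesis
    unfolding l_def v_def \<alpha>_def by (simp add: sum_divide_distrib diff_divide_distrib add_divide_distrib mult_ac)
qed

section \<open>Moments of the loss\<close>

lemma exp_le_quadratic:
  fixes x :: real
  assumes "\<bar>x\<bar> \<le> 1"
  shows "exp x \<le> 1 + x + x\<^sup>2"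
proof (cases "x \<ge> 0")
  case True
  then show ?thesis using assms by (intro exp_bound) auto
next
  case False
  define y where "y = - x"
  have y: "0 \<le> y" "y \<le> 1" using False assms by (auto simp: y_def)
  \<comment> \<open>For negative arguments the bound is equivalent to
    \<open>(1 - y + y^2) * exp y \<ge> 1\<close>. Replacing \<open>exp y\<close> by half of
    \<open>2 + 2 * y + y^2\<close> already suffices, because the middle terms of the product
    cancel.\<close>
  have "(1 - y + y\<^sup>2) * (2 + 2 * y + y\<^sup>2) = 2 + y\<^sup>2 + y ^ 3 + y ^ 4"
    by (simp add: algebra_simps power2_eq_square power3_eq_cube power4_eq_xxxx)
  then have "2 \<le> (1 - y + y\<^sup>2) * (2 + 2 * y + y\<^sup>2)" using y by simp
  also have "\<dots> \<le> (1 - y + y\<^sup>2) * (2 * exp y)"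
    using y exp_lower_Taylor_quadratic[of y] by (intro mult_left_mono) auto
  finally have "1 \<le> (1 - y + y\<^sup>2) * exp y" by simp
  then have "exp (- y) \<le> (1 - y + y\<^sup>2) * exp y * exp (- y)"
    using mult_right_mono[of 1 _ "exp (- y)"] by simp
  also have "\<dots> = 1 - y + y\<^sup>2" by (simp add: mult.assoc flip: exp_add)
  finally show ?thesis by (simp add: y_def)
qed

text \<open>A derivative is a pointwise limit of difference quotients, which are continuous. This
  covers \<open>deriv (deriv b)\<close>, whose continuity is not assumed.\<close>

lemma borel_measurable_deriv:
  fixes f :: "real \<Rightarrow> real"
  assumes "\<And>u. f differentiable (at u)"
  shows "deriv f \<in> borel_measurable borel"
proof (rule borel_measurable_LIMSEQ_real)
  have cont: "continuous_on UNIV f"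
    using assms by (simp add: continuous_at_imp_continuous_on differentiable_imp_continuous_within)
  show "(\<lambda>u. (f (u + 1 / Suc n) - f u) / (1 / Suc n)) \<in> borel_measurable borel" for n
    using borel_measurable_continuous_onI[OF cont] by measurable
  fix u
  have "((\<lambda>h. (f (u + h) - f u) / h) \<longlongrightarrow> deriv f u) (at 0)"
    using assms[of u] by (simp add: DERIV_deriv_iff_real_differentiable flip: DERIV_def)
  moreover have "filterlim (\<lambda>n. 1 / Suc n) (at (0::real)) sequentially"
    using LIMSEQ_Suc[OF lim_1_over_n[where 'a = real]] by (auto simp: filterlim_at)
  ultimately show "(\<lambda>n. (f (u + 1 / Suc n) - f u) / (1 / Suc n)) \<longlonglongrightarrow> deriv f u"
    by (rule filterlim_compose)
qed

text \<open>The second derivative need not be continuous, so a bound on it along almost all of the segment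
  is exploited through the fundamental theorem of calculus for the gauge integral.\<close>

lemma taylor_lower_bound_AE:
  fixes f :: "real \<Rightarrow> real"
  assumes f: "\<And>u. f differentiable (at u)" "\<And>u. deriv f differentiable (at u)"
    and ae: "AE s in lborel. s \<in> {0..1} \<longrightarrow> c \<le> deriv (deriv f) (u + s * d)"
  shows "f u + deriv f u * d + c * d\<^sup>2 / 2 \<le> f (u + d)"
proof -
  \<comment> \<open>Chosen so that \<open>F 1 - F 0\<close> is the first-order Taylor remainder,
    while differentiation cancels every term except the one with the second derivative.\<close>
  define F where "F s = (1 - s) * (deriv f (u + s * d) * d) + f (u + s * d)" for s
  define F' where "F' s = (1 - s) * (deriv (deriv f) (u + s * d) * d\<^sup>2)" for s
  have F: "(F has_real_derivative F' s) (at s)" for s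
  proof -
    have lin: "((\<lambda>s. u + s * d) has_real_derivative d) (at s)"
      by (auto intro!: derivative_eq_intros)
    have A: "((\<lambda>s. f (u + s * d)) has_real_derivative deriv f (u + s * d) * d) (at s)"
      by (rule DERIV_chain2[OF _ lin]) (use f(1) in \<open>simp add: DERIV_deriv_iff_real_differentiable\<close>)
    have B: "((\<lambda>s. deriv f (u + s * d)) has_real_derivative deriv (deriv f) (u + s * d) * d) (at s)"
      by (rule DERIV_chain2[OF _ lin]) (use f(2) in \<open>simp add: DERIV_deriv_iff_real_differentiable\<close>)
    have C: "((\<lambda>s. 1 - s) has_real_derivative - 1) (at s)"
      by (auto intro!: derivative_eq_intros)
    show ?thesis
      unfolding F_def F'_def
      by (rule DERIV_cong[OF DERIV_add[OF DERIV_mult[OF C DERIV_cmult_right[OF B, of d]] A]])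
        (simp add: algebra_simps power2_eq_square)
  qed
  have F'_int: "(F' has_integral (F 1 - F 0)) {0..1}"
    by (rule fundamental_theorem_of_calculus)
      (simp_all add: has_field_derivative_at_within[OF F] flip: has_real_derivative_iff_has_vector_derivative)
  \<comment> \<open>Modifying \<open>F'\<close> on a null set makes the lower bound hold at every
    point of the interval without changing the integral.\<close>
  define G where "G s = (if c \<le> deriv (deriv f) (u + s * d) then F' s else (1 - s) * (c * d\<^sup>2))" for s
  have "AE s in lborel. s \<in> {0..1} \<longrightarrow> F' s = G s" using ae by eventually_elim (auto simp: G_def)
  from has_integral_AE[OF this] F'_int have "(G has_integral (F 1 - F 0)) {0..1}" by blast
  moreover have "((\<lambda>s. (1 - s) * (c * d\<^sup>2)) has_integral (c * d\<^sup>2 / 2)) {0..1}"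
  proof -
    have "((\<lambda>s. (1 - s) * (c * d\<^sup>2)) has_integral
        ((1 - 1\<^sup>2 / 2) * (c * d\<^sup>2) - (0 - 0\<^sup>2 / 2) * (c * d\<^sup>2))) {0..1}"
    proof (rule fundamental_theorem_of_calculus)
      show "((\<lambda>s. (s - s\<^sup>2 / 2) * (c * d\<^sup>2)) has_vector_derivative (1 - s) * (c * d\<^sup>2)) (at s within {0..1})" for s
        unfolding has_real_derivative_iff_has_vector_derivative[symmetric]
        by (auto intro!: derivative_eq_intros)
    qed simp
    then show ?thesis by simp
  qed
  moreover have "(1 - s) * (c * d\<^sup>2) \<le> G s" if "s \<in> {0..1}" for s
    using that by (simp add: G_def F'_def mult_left_mono mult_right_mono)
  ultimately have "c * d\<^sup>2 / 2 \<le> F 1 - F 0" by (metis (no_types, lifting) has_integral_le)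
  then show ?thesis by (simp add: F_def)
qed

text \<open>Everything concerns the law \<open>\<mu>\<close> of one observation and one fixed
  radius, so the state of the filter enters only as a frozen parameter. The loss omits
  \<open>- ln (h y)\<close>, which is the same for all parameters.\<close>

locale local_glm = prob_space \<mu>
  for \<mu> :: "((real ^ 'n::finite) \<times> real) measure" +
  fixes a :: real and b :: "real \<Rightarrow> real" and \<theta>star :: "real ^ 'n" and \<epsilon> \<kappa> H \<rho> D :: real
  assumes sets_\<mu> [measurable_cong]: "sets \<mu> = sets borel"
    and a_pos: "a > 0"
    and b_diff: "\<And>u. b differentiable (at u)"
    and b'_diff: "\<And>u. deriv b differentiable (at u)"
    and b''_nonneg: "\<And>u. deriv (deriv b) u \<ge> 0"
    and integrable_loss: "\<And>\<phi>. integrable \<mu> (\<lambda>z. (b (\<phi> \<bullet> fst z) - snd z * (\<phi> \<bullet> fst z)) / a)"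
    and bounded: "AE z in \<mu>. norm (fst z) \<le> D"
    and minimum: "\<And>\<phi>. (LINT z|\<mu>. (b (\<theta>star \<bullet> fst z) - snd z * (\<theta>star \<bullet> fst z)) / a)
                     \<le> (LINT z|\<mu>. (b (\<phi> \<bullet> fst z) - snd z * (\<phi> \<bullet> fst z)) / a)"
    and \<epsilon>_pos: "\<epsilon> > 0" and \<kappa>_nonneg: "\<kappa> \<ge> 0" and \<rho>_gt: "\<rho> > 0.95"
    and gradient_bound: "\<And>\<phi>. norm (\<phi> - \<theta>star) \<le> \<epsilon> \<Longrightarrow> AE z in \<mu>.
      ((deriv b (\<phi> \<bullet> fst z) - snd z) / a)\<^sup>2 \<le> \<kappa> * (deriv (deriv b) (\<phi> \<bullet> fst z) / a)"
    and hessian_bound: "\<And>\<phi>. norm (\<phi> - \<theta>star) \<le> \<epsilon> \<Longrightarrow> AE z in \<mu>. deriv (deriv b) (\<phi> \<bullet> fst z) / a \<le> H"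
    and hessian_ratio: "\<And>\<phi> \<phi>'. norm (\<phi> - \<theta>star) \<le> \<epsilon> \<Longrightarrow> norm (\<phi>' - \<theta>star) \<le> \<epsilon> \<Longrightarrow>
      AE z in \<mu>. \<rho> * deriv (deriv b) (\<phi>' \<bullet> fst z) \<le> deriv (deriv b) (\<phi> \<bullet> fst z)"
begin

definition loss :: "real ^ 'n \<Rightarrow> (real ^ 'n) \<times> real \<Rightarrow> real" where
  "loss \<phi> z = (b (\<phi> \<bullet> fst z) - snd z * (\<phi> \<bullet> fst z)) / a"

definition risk :: "real ^ 'n \<Rightarrow> real" where
  "risk \<phi> = (LINT z|\<mu>. loss \<phi> z)"

definition grad :: "real ^ 'n \<Rightarrow> real ^ 'n \<Rightarrow> (real ^ 'n) \<times> real \<Rightarrow> real" where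
  "grad \<phi> v z = (deriv b (\<phi> \<bullet> fst z) - snd z) / a * (v \<bullet> fst z)"

definition hess :: "real ^ 'n \<Rightarrow> real ^ 'n \<Rightarrow> (real ^ 'n) \<times> real \<Rightarrow> real" where
  "hess \<phi> v z = deriv (deriv b) (\<phi> \<bullet> fst z) / a * (v \<bullet> fst z)\<^sup>2"

lemma b_cont: "continuous_on UNIV b" and b'_cont: "continuous_on UNIV (deriv b)"
  using b_diff b'_diff
  by (simp_all add: continuous_at_imp_continuous_on differentiable_imp_continuous_within)

lemma borel_b [measurable]:
  "b \<in> borel_measurable borel" "deriv b \<in> borel_measurable borel"
  "deriv (deriv b) \<in> borel_measurable borel"
  using b_cont b'_cont borel_measurable_deriv[OF b'_diff] by (auto intro: borel_measurable_continuous_onI)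

lemma borel_\<mu>: "f \<in> borel_measurable borel \<Longrightarrow> f \<in> borel_measurable \<mu>"
  using measurable_cong_sets[OF sets_\<mu> refl] by blast

lemma measurable_fst_snd [measurable]: "fst \<in> borel_measurable \<mu>" "snd \<in> borel_measurable \<mu>"
  by (intro borel_\<mu> borel_measurable_continuous_onI continuous_intros)+

text \<open>Measurability is needed jointly in parameter and observation, since the parameter is
  later replaced by the random state of the filter.\<close>

lemma borel_loss: "(\<lambda>(\<phi>, z). loss \<phi> z) \<in> borel_measurable borel"
  unfolding loss_def by (simp add: split_beta' borel_prod[symmetric]) measurable

lemma borel_grad: "(\<lambda>(\<phi>, z). grad \<phi> (\<phi> - \<theta>star) z) \<in> borel_measurable borel"
  unfolding grad_def by (simp add: split_beta' borel_prod[symmetric]) measurable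

lemma borel_hess: "(\<lambda>(\<phi>, z). hess \<phi> (\<phi> - \<theta>star) z) \<in> borel_measurable borel"
  unfolding hess_def by (simp add: split_beta' borel_prod[symmetric]) measurable

lemma borel_grad_fixed [measurable]: "grad \<phi> v \<in> borel_measurable \<mu>"
  unfolding grad_def by (intro borel_\<mu>) (simp add: borel_prod[symmetric])

lemma borel_hess_fixed [measurable]: "hess \<phi> v \<in> borel_measurable \<mu>"
  unfolding hess_def by (intro borel_\<mu>) (simp add: borel_prod[symmetric])

lemma integrable_loss': "integrable \<mu> (loss \<phi>)"
  using integrable_loss[of \<phi>] by (simp add: loss_def[abs_def])

lemma borel_risk [measurable]: "risk \<in> borel_measurable borel"
proof -
  have "sets (borel \<Otimes>\<^sub>M \<mu>) = sets (borel :: ((real ^ 'n) \<times> (real ^ 'n) \<times> real) measure)"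
    using sets_pair_measure_cong[OF refl[of "sets (borel :: (real ^ 'n) measure)"] sets_\<mu>]
    by (simp only: borel_prod)
  then have "(\<lambda>(\<phi>, z). loss \<phi> z) \<in> borel_measurable (borel \<Otimes>\<^sub>M \<mu>)"
    using borel_loss measurable_cong_sets by blast
  then show ?thesis unfolding risk_def[abs_def] by (intro borel_measurable_lebesgue_integral)
qed

lemma hess_nonneg: "0 \<le> hess \<phi> v z"
  using a_pos b''_nonneg by (simp add: hess_def)

lemma H_nonneg: "H \<ge> 0"
proof -
  have "AE z in \<mu>. 0 \<le> H"
    using hessian_bound[of \<theta>star, simplified, OF less_imp_le[OF \<epsilon>_pos]]
    by eventually_elim (rule order_trans[OF divide_nonneg_pos[OF b''_nonneg a_pos]])
  then show ?thesis by simp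
qed

lemma AE_grad_le_hess:
  assumes "norm (\<phi> - \<theta>star) \<le> \<epsilon>"
  shows "AE z in \<mu>. (grad \<phi> v z)\<^sup>2 \<le> \<kappa> * hess \<phi> v z"
  using gradient_bound[OF assms]
proof eventually_elim
  case (elim z)
  from mult_right_mono[OF this zero_le_power2[of "v \<bullet> fst z"]] show ?case
    by (simp only: grad_def hess_def power_mult_distrib mult.assoc)
qed

lemma AE_hess_le:
  assumes "norm (\<phi> - \<theta>star) \<le> \<epsilon>" and v: "norm v \<le> \<epsilon>"
  shows "AE z in \<mu>. hess \<phi> v z \<le> H * \<epsilon>\<^sup>2 * D\<^sup>2"
  using hessian_bound[OF assms(1)] bounded
proof eventually_elim
  case (elim z)
  have "\<bar>v \<bullet> fst z\<bar> \<le> \<epsilon> * D"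
    using elim v \<epsilon>_pos by (intro order_trans[OF Cauchy_Schwarz_ineq2] mult_mono) auto
  then have "(v \<bullet> fst z)\<^sup>2 \<le> (\<epsilon> * D)\<^sup>2"
    using power_mono[of "\<bar>v \<bullet> fst z\<bar>" "\<epsilon> * D" 2] by simp
  then have "hess \<phi> v z \<le> H * (\<epsilon> * D)\<^sup>2"
    unfolding hess_def using elim a_pos b''_nonneg H_nonneg by (intro mult_mono) auto
  then show ?case by (simp add: power_mult_distrib mult.assoc)
qed

text \<open>The gradient is at most the geometric mean of \<kappa> and the Hessian bound; passing to
  the arithmetic mean gives a bound linear in both, comparable with \<open>1 / l\<close>.\<close>

lemma AE_grad_le:
  assumes "norm (\<phi> - \<theta>star) \<le> \<epsilon>" and v: "norm v \<le> \<epsilon>"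
  shows "AE z in \<mu>. \<bar>grad \<phi> v z\<bar> \<le> (\<kappa> + H * \<epsilon>\<^sup>2 * D\<^sup>2) / 2"
  using AE_grad_le_hess[OF assms(1), of v] AE_hess_le[OF assms]
proof eventually_elim
  case (elim z)
  define q where "q = H * \<epsilon>\<^sup>2 * D\<^sup>2"
  have q: "q \<ge> 0" using H_nonneg by (simp add: q_def)
  have "(grad \<phi> v z)\<^sup>2 \<le> \<kappa> * q"
    using elim \<kappa>_nonneg unfolding q_def by (intro order_trans[OF elim(1)] mult_left_mono)
  also have "\<dots> \<le> ((\<kappa> + q) / 2)\<^sup>2"
    using zero_le_power2[of "\<kappa> - q"] by (simp add: power2_eq_square field_simps)
  finally show ?case
    using \<kappa>_nonneg q unfolding q_def[symmetric] by (simp add: abs_le_square_iff[symmetric])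
qed

lemma integrable_hess:
  assumes "norm (\<phi> - \<theta>star) \<le> \<epsilon>" "norm v \<le> \<epsilon>"
  shows "integrable \<mu> (hess \<phi> v)"
  using AE_hess_le[OF assms] hess_nonneg
  by (intro integrable_const_bound[where B = "H * \<epsilon>\<^sup>2 * D\<^sup>2"]) auto

lemma integrable_grad:
  assumes "norm (\<phi> - \<theta>star) \<le> \<epsilon>" "norm v \<le> \<epsilon>"
  shows "integrable \<mu> (grad \<phi> v)"
  using AE_grad_le[OF assms]
  by (intro integrable_const_bound[where B = "(\<kappa> + H * \<epsilon>\<^sup>2 * D\<^sup>2) / 2"]) auto

lemma norm_convex_comb_le:
  assumes "norm (\<phi> - \<theta>star) \<le> \<epsilon>" "norm (\<phi>' - \<theta>star) \<le> \<epsilon>" "s \<in> {0..1}"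
  shows "norm (\<phi> + s *\<^sub>R (\<phi>' - \<phi>) - \<theta>star) \<le> \<epsilon>"
proof -
  have "convex (cball \<theta>star \<epsilon>)" by simp
  moreover have "\<phi> \<in> cball \<theta>star \<epsilon>" "\<phi>' \<in> cball \<theta>star \<epsilon>"
    using assms by (auto simp: dist_norm norm_minus_commute)
  ultimately have "(1 - s) *\<^sub>R \<phi> + s *\<^sub>R \<phi>' \<in> cball \<theta>star \<epsilon>"
    using assms(3) by (auto simp: convex_alt)
  moreover have "(1 - s) *\<^sub>R \<phi> + s *\<^sub>R \<phi>' = \<phi> + s *\<^sub>R (\<phi>' - \<phi>)" by (simp add: algebra_simps)
  ultimately show ?thesis by (simp add: dist_norm norm_minus_commute)
qed

text \<open>For each point \<open>s\<close> of the segment the Hessian comparison has its own null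
  set of observations. Fubini exchanges the quantifiers: for almost every observation it holds at
  almost every \<open>s\<close>, which is what \<open>taylor_lower_bound_AE\<close> accepts. The
  separate reference point \<psi> lets expansions from either end use the same Hessian form.\<close>

lemma AE_loss_taylor:
  assumes "norm (\<phi> - \<theta>star) \<le> \<epsilon>" "norm (\<phi>' - \<theta>star) \<le> \<epsilon>" "norm (\<psi> - \<theta>star) \<le> \<epsilon>"
  shows "AE z in \<mu>. loss \<phi> z + grad \<phi> (\<phi>' - \<phi>) z + \<rho> / 2 * hess \<psi> (\<phi>' - \<phi>) z \<le> loss \<phi>' z"
proof -
  interpret pair_sigma_finite \<mu> lborel ..
  let ?P = "\<lambda>z s. s \<in> {0..1} \<longrightarrow>
      \<rho> * deriv (deriv b) (\<psi> \<bullet> fst z) \<le> deriv (deriv b) (\<phi> \<bullet> fst z + s * ((\<phi>' - \<phi>) \<bullet> fst z))"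
  have meas: "{x \<in> space (\<mu> \<Otimes>\<^sub>M lborel). ?P (fst x) (snd x)} \<in> sets (\<mu> \<Otimes>\<^sub>M lborel)"
    by measurable
  have "AE s in lborel. AE z in \<mu>. s \<in> {0..1} \<longrightarrow>
      \<rho> * deriv (deriv b) (\<psi> \<bullet> fst z) \<le> deriv (deriv b) (\<phi> \<bullet> fst z + s * ((\<phi>' - \<phi>) \<bullet> fst z))"
  proof (rule AE_I2)
    fix s :: real
    show "AE z in \<mu>. s \<in> {0..1} \<longrightarrow>
      \<rho> * deriv (deriv b) (\<psi> \<bullet> fst z) \<le> deriv (deriv b) (\<phi> \<bullet> fst z + s * ((\<phi>' - \<phi>) \<bullet> fst z))"
    proof (cases "s \<in> {0..1}")
      case True
      from hessian_ratio[OF norm_convex_comb_le[OF assms(1,2) True] assms(3)] show ?thesis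
        by (simp add: inner_add_left)
    qed auto
  qed
  then have "AE z in \<mu>. AE s in lborel. s \<in> {0..1} \<longrightarrow>
      \<rho> * deriv (deriv b) (\<psi> \<bullet> fst z) \<le> deriv (deriv b) (\<phi> \<bullet> fst z + s * ((\<phi>' - \<phi>) \<bullet> fst z))"
    by (rule AE_commute[where P = ?P, THEN iffD2, OF meas])
  then show ?thesis
  proof eventually_elim
    case (elim z)
    define d where "d = (\<phi>' - \<phi>) \<bullet> fst z"
    have "b (\<phi> \<bullet> fst z) + deriv b (\<phi> \<bullet> fst z) * d + \<rho> * deriv (deriv b) (\<psi> \<bullet> fst z) * d\<^sup>2 / 2
        \<le> b (\<phi> \<bullet> fst z + d)"
      using elim unfolding d_def by (rule taylor_lower_bound_AE[OF b_diff b'_diff])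
    also have "\<phi> \<bullet> fst z + d = \<phi>' \<bullet> fst z" by (simp add: d_def inner_diff_left)
    finally have "(b (\<phi> \<bullet> fst z) + deriv b (\<phi> \<bullet> fst z) * d + \<rho> * deriv (deriv b) (\<psi> \<bullet> fst z) * d\<^sup>2 / 2
        - snd z * (\<phi>' \<bullet> fst z)) / a \<le> loss \<phi>' z"
      unfolding loss_def using a_pos by (intro divide_right_mono) auto
    also have "(b (\<phi> \<bullet> fst z) + deriv b (\<phi> \<bullet> fst z) * d + \<rho> * deriv (deriv b) (\<psi> \<bullet> fst z) * d\<^sup>2 / 2
        - snd z * (\<phi>' \<bullet> fst z)) / a = loss \<phi> z + grad \<phi> (\<phi>' - \<phi>) z + \<rho> / 2 * hess \<psi> (\<phi>' - \<phi>) z"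
      unfolding loss_def grad_def hess_def d_def[symmetric]
      by (simp only: \<open>\<phi> \<bullet> fst z + d = \<phi>' \<bullet> fst z\<close>[symmetric])
        (simp add: add_divide_distrib diff_divide_distrib ring_distribs mult_ac)
    finally show ?case .
  qed
qed

lemma risk_taylor:
  assumes "norm (\<phi> - \<theta>star) \<le> \<epsilon>" "norm (\<phi>' - \<theta>star) \<le> \<epsilon>" "norm (\<psi> - \<theta>star) \<le> \<epsilon>"
    and v: "norm (\<phi>' - \<phi>) \<le> \<epsilon>"
  shows "risk \<phi> + (LINT z|\<mu>. grad \<phi> (\<phi>' - \<phi>) z) + \<rho> / 2 * (LINT z|\<mu>. hess \<psi> (\<phi>' - \<phi>) z) \<le> risk \<phi>'"
proof -
  note int = integrable_loss' integrable_grad[OF assms(1) v] integrable_hess[OF assms(3) v]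
  have "(LINT z|\<mu>. loss \<phi> z + grad \<phi> (\<phi>' - \<phi>) z + \<rho> / 2 * hess \<psi> (\<phi>' - \<phi>) z) \<le> risk \<phi>'"
    unfolding risk_def using int by (intro integral_mono_AE AE_loss_taylor assms) auto
  then show ?thesis using int by (simp add: risk_def)
qed

text \<open>First-order optimality without differentiating under the integral. Expanding from a
  point \<open>\<theta>star + s *\<^sub>R v\<close> back to the minimizer shows that the mean
  gradient there along \<open>v\<close> is nonnegative; as \<open>s\<close> tends to zero, dominated
  convergence applies because gradients are bounded in the ball.\<close>

lemma expected_grad_minimum:
  assumes v: "norm v \<le> \<epsilon>"
  shows "(LINT z|\<mu>. grad \<theta>star v z) \<ge> 0"
proof -
  define s where "s n = 1 / real (Suc n)" for n
  define \<phi> where "\<phi> n = \<theta>star + s n *\<^sub>R v" for n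
  have s: "0 < s n" "s n \<le> 1" for n by (auto simp: s_def)
  have ball: "norm (\<phi> n - \<theta>star) \<le> \<epsilon>" for n
  proof -
    have "s n * norm v \<le> 1 * norm v" using s[of n] by (intro mult_right_mono) auto
    then show ?thesis using v s[of n] by (simp add: \<phi>_def)
  qed
  have nonneg: "(LINT z|\<mu>. grad (\<phi> n) v z) \<ge> 0" for n
  proof -
    have "risk (\<phi> n) + (LINT z|\<mu>. grad (\<phi> n) (\<theta>star - \<phi> n) z)
        + \<rho> / 2 * (LINT z|\<mu>. hess \<theta>star (\<theta>star - \<phi> n) z) \<le> risk \<theta>star"
      using ball[of n] \<epsilon>_pos by (intro risk_taylor) (auto simp: norm_minus_commute)
    moreover have "risk \<theta>star \<le> risk (\<phi> n)"
      using minimum[of "\<phi> n"] by (simp add: risk_def loss_def)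
    moreover have "(LINT z|\<mu>. hess \<theta>star (\<theta>star - \<phi> n) z) \<ge> 0"
      by (intro integral_nonneg_AE) (simp add: hess_nonneg)
    then have "\<rho> / 2 * (LINT z|\<mu>. hess \<theta>star (\<theta>star - \<phi> n) z) \<ge> 0" using \<rho>_gt by simp
    moreover have "grad (\<phi> n) (\<theta>star - \<phi> n) z = - s n * grad (\<phi> n) v z" for z
      by (simp add: grad_def \<phi>_def)
    ultimately have "s n * (LINT z|\<mu>. grad (\<phi> n) v z) \<ge> 0" by simp
    then show ?thesis using s(1)[of n] by (simp add: zero_le_mult_iff)
  qed
  have "(\<lambda>n. LINT z|\<mu>. grad (\<phi> n) v z) \<longlonglongrightarrow> (LINT z|\<mu>. grad \<theta>star v z)"
  proof (rule integral_dominated_convergence[where w = "\<lambda>_. (\<kappa> + H * \<epsilon>\<^sup>2 * D\<^sup>2) / 2"])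
    have "s \<longlonglongrightarrow> 0" unfolding s_def using LIMSEQ_Suc[OF lim_1_over_n[where 'a = real]] by simp
    then have "\<phi> \<longlonglongrightarrow> \<theta>star + 0 *\<^sub>R v" unfolding \<phi>_def by (intro tendsto_intros)
    then have lim: "\<phi> \<longlonglongrightarrow> \<theta>star" by simp
    have "(\<lambda>n. grad (\<phi> n) v z) \<longlonglongrightarrow> grad \<theta>star v z" for z
    proof -
      have "(\<lambda>n. deriv b (\<phi> n \<bullet> fst z)) \<longlonglongrightarrow> deriv b (\<theta>star \<bullet> fst z)"
        by (rule continuous_on_tendsto_compose[OF b'_cont]) (auto intro!: tendsto_intros lim)
      then show ?thesis unfolding grad_def using a_pos by (intro tendsto_intros) auto
    qed
    then show "AE z in \<mu>. (\<lambda>n. grad (\<phi> n) v z) \<longlonglongrightarrow> grad \<theta>star v z" by simp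
    show "AE z in \<mu>. norm (grad (\<phi> n) v z) \<le> (\<kappa> + H * \<epsilon>\<^sup>2 * D\<^sup>2) / 2" for n
      using AE_grad_le[OF ball v] by simp
  qed auto
  then show ?thesis using nonneg by (intro LIMSEQ_le_const) auto
qed

lemma risk_excess_bounds:
  assumes \<phi>: "norm (\<phi> - \<theta>star) \<le> \<epsilon>"
  defines "G \<equiv> LINT z|\<mu>. grad \<phi> (\<phi> - \<theta>star) z" and "Q \<equiv> LINT z|\<mu>. hess \<phi> (\<phi> - \<theta>star) z"
  shows "risk \<phi> - risk \<theta>star \<le> G - \<rho> / 2 * Q" "\<rho> / 2 * Q \<le> risk \<phi> - risk \<theta>star"
proof -
  have *: "norm (\<theta>star - \<phi>) \<le> \<epsilon>" "norm (\<theta>star - \<theta>star) \<le> \<epsilon>"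
    using \<phi> \<epsilon>_pos by (auto simp: norm_minus_commute)
  have "grad \<phi> (\<theta>star - \<phi>) z = - grad \<phi> (\<phi> - \<theta>star) z" for z
    unfolding grad_def using inner_minus_left[of "\<phi> - \<theta>star" "fst z"] by simp
  moreover have "hess \<phi> (\<theta>star - \<phi>) z = hess \<phi> (\<phi> - \<theta>star) z" for z
    by (simp add: hess_def inner_diff_left power2_commute)
  ultimately show "risk \<phi> - risk \<theta>star \<le> G - \<rho> / 2 * Q"
    using risk_taylor[OF \<phi> *(2) \<phi> *(1)] by (simp add: G_def Q_def)
  show "\<rho> / 2 * Q \<le> risk \<phi> - risk \<theta>star"
    using risk_taylor[OF *(2) \<phi> \<phi> \<phi>] expected_grad_minimum[OF \<phi>] by (simp add: Q_def)
qed

text \<open>The slack between \<open>\<rho>\<close> and \<open>1\<close> in \<open>risk_excess_bounds\<close>, together with the fifth of the excess risk that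
  is kept, leaves a multiple of the expected Hessian form that absorbs the exponential second moment.\<close>

lemma exponential_moment:
  assumes \<phi>: "norm (\<phi> - \<theta>star) \<le> \<epsilon>"
    and l: "l \<ge> 0" "l * (6 * (2 * \<kappa> + H * \<epsilon>\<^sup>2 * D\<^sup>2)) \<le> 1"
  shows "(\<integral>\<^sup>+ z. ennreal (exp (l * ((risk \<phi> - risk \<theta>star) / 5
             - grad \<phi> (\<phi> - \<theta>star) z + hess \<phi> (\<phi> - \<theta>star) z / 2))) \<partial>\<mu>) \<le> 1"
proof -
  define g where "g z = grad \<phi> (\<phi> - \<theta>star) z" for z
  define h where "h z = hess \<phi> (\<phi> - \<theta>star) z" for z
  define G where "G = (LINT z|\<mu>. g z)"
  define Q where "Q = (LINT z|\<mu>. h z)"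
  define q where "q = H * \<epsilon>\<^sup>2 * D\<^sup>2"
  define R where "R = risk \<phi> - risk \<theta>star"
  have q: "q \<ge> 0" using H_nonneg by (simp add: q_def)
  have [measurable]: "g \<in> borel_measurable \<mu>" "h \<in> borel_measurable \<mu>"
    by (simp_all add: g_def[abs_def] h_def[abs_def])
  have int: "integrable \<mu> g" "integrable \<mu> h"
    using integrable_grad[OF \<phi> \<phi>] integrable_hess[OF \<phi> \<phi>] by (simp_all add: g_def[abs_def] h_def[abs_def])
  have h0: "0 \<le> h z" for z by (simp add: h_def hess_nonneg)
  then have Q: "Q \<ge> 0" unfolding Q_def by (intro integral_nonneg_AE) simp
  have "R \<le> G - \<rho> / 2 * Q" "\<rho> / 2 * Q \<le> R"
    using risk_excess_bounds[OF \<phi>] by (simp_all add: R_def G_def Q_def g_def h_def)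
  moreover have "0.95 * Q \<le> \<rho> * Q" using \<rho>_gt Q by (intro mult_right_mono) auto
  \<comment> \<open>Write \<open>R / 5\<close> as \<open>R - 4 / 5 * R\<close>, bounding the first
    term from above and the second from below. The coefficient of \<open>Q\<close> becomes
    \<open>9 / 10 * \<rho>\<close>, at least 0.855, which exceeds 2/3.\<close>
  ultimately have R: "R / 5 \<le> G - 2 / 3 * Q" using Q by simp
  have ae: "AE z in \<mu>. exp (l * (h z / 2 - g z)) \<le> 1 + l * (h z / 2 - g z) + l * h z / 6"
    using AE_grad_le[OF \<phi> \<phi>] AE_grad_le_hess[OF \<phi>, of "\<phi> - \<theta>star"] AE_hess_le[OF \<phi> \<phi>]
  proof eventually_elim
    case (elim z)
    have e: "\<bar>g z\<bar> \<le> (\<kappa> + q) / 2" "(g z)\<^sup>2 \<le> \<kappa> * h z" "h z \<le> q"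
      using elim by (simp_all add: g_def h_def q_def)
    have "\<bar>h z / 2 - g z\<bar> \<le> 6 * (2 * \<kappa> + q)"
      unfolding abs_le_iff using abs_le_D1[OF e(1)] abs_le_D2[OF e(1)] e(3) h0[of z] \<kappa>_nonneg q
      by (auto simp: field_simps)
    then have "l * \<bar>h z / 2 - g z\<bar> \<le> 1"
      using l mult_left_mono[of "\<bar>h z / 2 - g z\<bar>" "6 * (2 * \<kappa> + q)" l] unfolding q_def by linarith
    then have "exp (l * (h z / 2 - g z)) \<le> 1 + l * (h z / 2 - g z) + (l * (h z / 2 - g z))\<^sup>2"
      using l by (intro exp_le_quadratic) (simp add: abs_mult)
    \<comment> \<open>The square is quadratic in \<open>l\<close>; one factor \<open>l\<close> is
      spent on the condition \<open>l * (6 * (2 * \<kappa> + q)) \<le> 1\<close>, which leaves a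
      term linear in the Hessian form.\<close>
    also have "(l * (h z / 2 - g z))\<^sup>2 \<le> l * h z / 6"
    proof -
      have "(h z / 2 - g z)\<^sup>2 \<le> (h z)\<^sup>2 / 2 + 2 * (g z)\<^sup>2"
        using zero_le_power2[of "h z / 2 + g z"] by (simp add: power2_eq_square field_simps)
      also have "\<dots> \<le> h z * (2 * \<kappa> + q)"
      proof -
        have "(h z)\<^sup>2 \<le> h z * q" using e h0[of z] by (simp add: power2_eq_square mult_left_mono)
        moreover have "0 \<le> h z * q" using h0 q by simp
        ultimately show ?thesis using e by (simp add: algebra_simps)
      qed
      finally have "l\<^sup>2 * (h z / 2 - g z)\<^sup>2 \<le> l\<^sup>2 * (h z * (2 * \<kappa> + q))"
        by (intro mult_left_mono) auto
      also have "\<dots> = (l * h z / 6) * (l * (6 * (2 * \<kappa> + q)))"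
        by (simp add: power2_eq_square)
      also have "\<dots> \<le> (l * h z / 6) * 1"
        using l h0[of z] unfolding q_def by (intro mult_left_mono) auto
      finally show ?thesis by (simp add: power_mult_distrib)
    qed
    finally show ?case by simp
  qed
  have "(\<integral>\<^sup>+ z. ennreal (exp (l * (R / 5 - g z + h z / 2))) \<partial>\<mu>)
      \<le> (\<integral>\<^sup>+ z. ennreal (exp (l * (R / 5)) * (1 + l * (h z / 2 - g z) + l * h z / 6)) \<partial>\<mu>)"
    using ae
  proof (intro nn_integral_mono_AE, eventually_elim)
    case (elim z)
    have "exp (l * (R / 5 - g z + h z / 2)) = exp (l * (R / 5)) * exp (l * (h z / 2 - g z))"
      by (simp add: exp_add[symmetric] algebra_simps)
    then show ?case using elim by (intro ennreal_leI) (simp add: mult_left_mono)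
  qed
  also have "\<dots> = ennreal (LINT z|\<mu>. exp (l * (R / 5)) * (1 + l * (h z / 2 - g z) + l * h z / 6))"
  proof (rule nn_integral_eq_integral)
    show "integrable \<mu> (\<lambda>z. exp (l * (R / 5)) * (1 + l * (h z / 2 - g z) + l * h z / 6))"
      using int by auto
    show "AE z in \<mu>. 0 \<le> exp (l * (R / 5)) * (1 + l * (h z / 2 - g z) + l * h z / 6)"
      using ae by eventually_elim (metis exp_ge_zero mult_nonneg_nonneg order_trans)
  qed
  also have "(LINT z|\<mu>. exp (l * (R / 5)) * (1 + l * (h z / 2 - g z) + l * h z / 6))
      = exp (l * (R / 5)) * (1 + l * (Q / 2 - G) + l * Q / 6)"
    using int by (simp add: G_def Q_def prob_space)
  \<comment> \<open>Applying \<open>1 + x \<le> exp x\<close> after integration gathers all terms in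
    one exponent, whose sign is decided by \<open>R\<close>.\<close>
  also have "ennreal \<dots> \<le> 1"
  proof -
    have "exp (l * (R / 5)) * (1 + l * (Q / 2 - G) + l * Q / 6)
        \<le> exp (l * (R / 5)) * exp (l * (Q / 2 - G) + l * Q / 6)"
      using exp_ge_add_one_self[of "l * (Q / 2 - G) + l * Q / 6"]
      by (intro mult_left_mono) (linarith, simp)
    also have "\<dots> = exp (l * (R / 5 - (G - 2 / 3 * Q)))"
      by (simp add: exp_add[symmetric] algebra_simps)
    also have "\<dots> \<le> 1" using R l by (simp add: mult_nonneg_nonpos)
    finally show ?thesis by (simp add: ennreal_le_1)
  qed
  finally show ?thesis unfolding R_def g_def h_def .
qed

end

section \<open>A maximal inequality for driven recursions\<close>

text \<open>Step \<open>t\<close> reads \<open>z (Suc t)\<close>, so the state at time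
  \<open>t\<close> depends on \<open>z 1\<close> up to \<open>z t\<close> only and
  \<open>z 0\<close> is never read. This matches observations numbered from 1.\<close>

primrec driven :: "(nat \<Rightarrow> 's \<times> 'z \<Rightarrow> 's) \<Rightarrow> 's \<Rightarrow> (nat \<Rightarrow> 'z) \<Rightarrow> nat \<Rightarrow> 's" where
  "driven F s z 0 = s"
| "driven F s z (Suc t) = F t (driven F s z t, z (Suc t))"

lemma driven_cong:
  assumes "\<And>i. 1 \<le> i \<Longrightarrow> i \<le> t \<Longrightarrow> z i = z' i"
  shows "driven F s z t = driven F s z' t"
  using assms by (induction t) auto

lemma borel_measurable_pair_comp:
  fixes F :: "'s::second_countable_topology \<times> 'z::second_countable_topology \<Rightarrow> 'c::topological_space"
  assumes F: "F \<in> borel_measurable borel" and f: "f \<in> borel_measurable M" and g: "g \<in> borel_measurable M"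
  shows "(\<lambda>x. F (f x, g x)) \<in> borel_measurable M"
proof -
  have "(\<lambda>x. (f x, g x)) \<in> borel_measurable M"
    using f g by (simp add: borel_prod[symmetric])
  from measurable_compose[OF this F] show ?thesis .
qed

lemma measurable_driven_PiM:
  fixes F :: "nat \<Rightarrow> 's::second_countable_topology \<times> 'z::second_countable_topology \<Rightarrow> 's"
  assumes F: "\<And>t. F t \<in> borel_measurable borel" and J: "{1..t} \<subseteq> J"
  shows "(\<lambda>z. driven F s z t) \<in> measurable (PiM J (\<lambda>_. borel)) borel"
  using J
proof (induction t)
  case (Suc t)
  have "(\<lambda>z. driven F s z t) \<in> measurable (PiM J (\<lambda>_. borel)) borel"
    by (intro Suc.IH subset_trans[OF _ Suc.prems]) auto
  moreover have "(\<lambda>z. z (Suc t)) \<in> measurable (PiM J (\<lambda>_. borel)) borel"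
    using Suc.prems by (intro measurable_component_singleton) auto
  ultimately show ?case unfolding driven.simps by (rule borel_measurable_pair_comp[OF F])
qed simp

context prob_space
begin

lemma measurable_driven:
  fixes F :: "nat \<Rightarrow> 's::second_countable_topology \<times> 'z::second_countable_topology \<Rightarrow> 's"
  assumes "\<And>t. F t \<in> borel_measurable borel" and "\<And>t. t \<ge> 1 \<Longrightarrow> Z t \<in> borel_measurable M"
  shows "(\<lambda>\<omega>. driven F s (\<lambda>i. Z i \<omega>) t) \<in> borel_measurable M"
  using assms by (induction t) (auto intro!: borel_measurable_pair_comp)

text \<open>The constant \<open>indep_var\<close> forces both variables to have the same type, so independence of the
  state and the next observation is expressed through their joint distribution.\<close>

lemma distr_driven_pair:
  fixes F :: "nat \<Rightarrow> 's::second_countable_topology \<times> 'z::second_countable_topology \<Rightarrow> 's"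
    and s :: 's and t :: nat
  assumes F: "\<And>t. F t \<in> borel_measurable borel" and Z: "indep_vars (\<lambda>_. borel) Z {1..}"
  defines "S \<equiv> \<lambda>\<omega>. driven F s (\<lambda>i. Z i \<omega>) t"
  shows "distr M (borel \<Otimes>\<^sub>M borel) (\<lambda>\<omega>. (S \<omega>, Z (Suc t) \<omega>)) = distr M borel S \<Otimes>\<^sub>M distr M borel (Z (Suc t))"
proof -
  define PA where "PA = PiM {1..t} (\<lambda>_. borel :: 'z measure)"
  define PB where "PB = PiM {Suc t} (\<lambda>_. borel :: 'z measure)"
  \<comment> \<open>Past and next observation are both kept as restricted functions on
    \<open>nat\<close>, so they have a common type and \<open>indep_var\<close> applies; state and
    observation are then read off from them.\<close>
  define A where "A = (\<lambda>\<omega>. restrict (\<lambda>i. Z i \<omega>) {1..t})"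
  define B where "B = (\<lambda>\<omega>. restrict (\<lambda>i. Z i \<omega>) {Suc t})"
  have "indep_var PA A PB B"
    unfolding PA_def PB_def A_def B_def by (rule indep_var_restrict[OF Z]) auto
  then have AB [measurable]: "A \<in> measurable M PA" "B \<in> measurable M PB"
    and eq: "distr M PA A \<Otimes>\<^sub>M distr M PB B = distr M (PA \<Otimes>\<^sub>M PB) (\<lambda>\<omega>. (A \<omega>, B \<omega>))"
    by (simp_all add: indep_var_distribution_eq)
  have f [measurable]: "(\<lambda>z. driven F s z t) \<in> measurable PA borel"
    unfolding PA_def by (rule measurable_driven_PiM[OF F]) simp
  have g [measurable]: "(\<lambda>z. z (Suc t)) \<in> measurable PB borel"
    unfolding PB_def by (rule measurable_component_singleton) simp
  have SA: "S = (\<lambda>z. driven F s z t) \<circ> A"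
    by (auto simp: S_def A_def fun_eq_iff intro!: driven_cong)
  have ZB: "Z (Suc t) = (\<lambda>z. z (Suc t)) \<circ> B"
    by (auto simp: B_def fun_eq_iff)
  have "prob_space (distr (distr M PB B) borel (\<lambda>z. z (Suc t)))"
    by (intro prob_space.prob_space_distr prob_space_distr) auto
  then have sf: "sigma_finite_measure (distr (distr M PB B) borel (\<lambda>z. z (Suc t)))"
    by (simp add: prob_space_imp_sigma_finite)
  have "distr M borel S \<Otimes>\<^sub>M distr M borel (Z (Suc t))
      = distr (distr M PA A) borel (\<lambda>z. driven F s z t) \<Otimes>\<^sub>M distr (distr M PB B) borel (\<lambda>z. z (Suc t))"
    unfolding SA ZB by (simp add: distr_distr)
  also have "\<dots> = distr (distr M PA A \<Otimes>\<^sub>M distr M PB B) (borel \<Otimes>\<^sub>M borel) (\<lambda>(x, y). (driven F s x t, y (Suc t)))"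
    by (rule pair_measure_distr) (use sf in auto)
  also have "\<dots> = distr M (borel \<Otimes>\<^sub>M borel) (\<lambda>\<omega>. (S \<omega>, Z (Suc t) \<omega>))"
    unfolding eq by (subst distr_distr) (auto simp: SA ZB comp_def)
  finally show ?thesis by simp
qed

text \<open>Plays the role of conditioning on the past: the inner integral freezes the state and
  averages over the next observation alone.\<close>

lemma nn_integral_driven:
  fixes F :: "nat \<Rightarrow> 's::second_countable_topology \<times> 'z::second_countable_topology \<Rightarrow> 's"
    and s :: 's and t :: nat
  assumes F: "\<And>t. F t \<in> borel_measurable borel" and Z: "indep_vars (\<lambda>_. borel) Z {1..}"
    and f: "f \<in> borel_measurable borel"
  defines "S \<equiv> \<lambda>\<omega>. driven F s (\<lambda>i. Z i \<omega>) t"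
  shows "(\<integral>\<^sup>+ \<omega>. f (S \<omega>, Z (Suc t) \<omega>) \<partial>M) = (\<integral>\<^sup>+ \<omega>. (\<integral>\<^sup>+ \<omega>'. f (S \<omega>, Z (Suc t) \<omega>') \<partial>M) \<partial>M)"
proof -
  have Z' [measurable]: "Z t \<in> borel_measurable M" if "t \<ge> 1" for t
    using Z that by (simp add: indep_vars_def)
  have [measurable]: "S \<in> borel_measurable M"
    unfolding S_def using F Z' by (rule measurable_driven)
  have f' [measurable]: "f \<in> borel_measurable (borel \<Otimes>\<^sub>M borel)" using f by (simp add: borel_prod)
  interpret PZ: prob_space "distr M borel (Z (Suc t))" by (rule prob_space_distr) simp
  have "(\<integral>\<^sup>+ \<omega>. f (S \<omega>, Z (Suc t) \<omega>) \<partial>M)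
      = (\<integral>\<^sup>+ p. f p \<partial>distr M (borel \<Otimes>\<^sub>M borel) (\<lambda>\<omega>. (S \<omega>, Z (Suc t) \<omega>)))"
    by (subst nn_integral_distr) auto
  also have "distr M (borel \<Otimes>\<^sub>M borel) (\<lambda>\<omega>. (S \<omega>, Z (Suc t) \<omega>)) = distr M borel S \<Otimes>\<^sub>M distr M borel (Z (Suc t))"
    unfolding S_def by (rule distr_driven_pair[OF F Z])
  also have "(\<integral>\<^sup>+ p. f p \<partial>(distr M borel S \<Otimes>\<^sub>M distr M borel (Z (Suc t))))
      = (\<integral>\<^sup>+ s. (\<integral>\<^sup>+ z. f (s, z) \<partial>distr M borel (Z (Suc t))) \<partial>distr M borel S)"
  proof (rule PZ.nn_integral_fst[symmetric])
    have "sets (distr M borel S \<Otimes>\<^sub>M distr M borel (Z (Suc t))) = sets (borel \<Otimes>\<^sub>M borel)"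
      by (intro sets_pair_measure_cong) auto
    then show "f \<in> borel_measurable (distr M borel S \<Otimes>\<^sub>M distr M borel (Z (Suc t)))"
      using f' measurable_cong_sets by blast
  qed
  also have "\<dots> = (\<integral>\<^sup>+ s. (\<integral>\<^sup>+ \<omega>'. f (s, Z (Suc t) \<omega>') \<partial>M) \<partial>distr M borel S)"
    by (intro nn_integral_cong nn_integral_distr) auto
  also have "\<dots> = (\<integral>\<^sup>+ \<omega>. (\<integral>\<^sup>+ \<omega>'. f (S \<omega>, Z (Suc t) \<omega>') \<partial>M) \<partial>M)"
    by (intro nn_integral_distr) auto
  finally show ?thesis .
qed

text \<open>The null set in the premise may depend on \<open>s\<close>, so the random state cannot
  simply be substituted. Integrating the indicator of the complement with the state frozen gives
  zero for each state, hence in total.\<close>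

lemma AE_driven:
  fixes F :: "nat \<Rightarrow> 's::second_countable_topology \<times> 'z::second_countable_topology \<Rightarrow> 's"
  assumes F: "\<And>t. F t \<in> borel_measurable borel" and Z: "indep_vars (\<lambda>_. borel) Z {1..}"
    and A: "A \<in> sets borel" and ae: "\<And>s. AE \<omega> in M. (s, Z (Suc t) \<omega>) \<in> A"
  shows "AE \<omega> in M. (driven F s0 (\<lambda>i. Z i \<omega>) t, Z (Suc t) \<omega>) \<in> A"
proof -
  have Z': "Z t \<in> borel_measurable M" if "t \<ge> 1" for t
    using Z that by (simp add: indep_vars_def)
  define S where "S = (\<lambda>\<omega>. driven F s0 (\<lambda>i. Z i \<omega>) t)"
  have S: "S \<in> borel_measurable M"
    unfolding S_def using F Z' by (rule measurable_driven)
  have A': "indicator (- A) \<in> borel_measurable borel" using A by simp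
  have "(\<integral>\<^sup>+ \<omega>. indicator (- A) (S \<omega>, Z (Suc t) \<omega>) \<partial>M)
      = (\<integral>\<^sup>+ \<omega>. (\<integral>\<^sup>+ \<omega>'. indicator (- A) (S \<omega>, Z (Suc t) \<omega>') \<partial>M) \<partial>M)"
    unfolding S_def by (rule nn_integral_driven[OF F Z A'])
  also have "\<dots> = (\<integral>\<^sup>+ \<omega>. 0 \<partial>M)"
  proof (rule nn_integral_cong)
    fix \<omega>
    have "(\<integral>\<^sup>+ \<omega>'. indicator (- A) (S \<omega>, Z (Suc t) \<omega>') \<partial>M) = (\<integral>\<^sup>+ \<omega>'. 0 \<partial>M)"
      using ae[of "S \<omega>"] by (intro nn_integral_cong_AE) (auto simp: indicator_def)
    then show "(\<integral>\<^sup>+ \<omega>'. indicator (- A) (S \<omega>, Z (Suc t) \<omega>') \<partial>M) = 0" by simp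
  qed
  finally have "(\<integral>\<^sup>+ \<omega>. indicator (- A) (S \<omega>, Z (Suc t) \<omega>) \<partial>M) = 0" by simp
  moreover have "(\<lambda>\<omega>. indicator (- A) (S \<omega>, Z (Suc t) \<omega>) :: ennreal) \<in> borel_measurable M"
    by (rule borel_measurable_pair_comp[OF A' S Z']) simp
  ultimately have "AE \<omega> in M. (indicator (- A) (S \<omega>, Z (Suc t) \<omega>) :: ennreal) = 0"
    by (simp add: nn_integral_0_iff_AE)
  then show ?thesis unfolding S_def by eventually_elim (auto simp: indicator_def split: if_splits)
qed

text \<open>Ville's inequality. The supermartingale \<open>exp (\<Sum>i<t. u i)\<close> is stopped at the level \<open>exp c\<close> by
  carrying the stopped sum as an additional component of the state.\<close>

lemma maximal_inequality_driven:
  fixes F :: "nat \<Rightarrow> 's::second_countable_topology \<times> 'z::second_countable_topology \<Rightarrow> 's"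
    and s0 :: 's
    and u :: "nat \<Rightarrow> 's \<times> 'z \<Rightarrow> real"
  assumes F: "\<And>t. F t \<in> borel_measurable borel" and Z: "indep_vars (\<lambda>_. borel) Z {1..}"
    and u: "\<And>t. u t \<in> borel_measurable borel"
    and moment: "\<And>t s. (\<integral>\<^sup>+ \<omega>. ennreal (exp (u t (s, Z (Suc t) \<omega>))) \<partial>M) \<le> 1"
  defines "S \<equiv> \<lambda>t \<omega>. driven F s0 (\<lambda>i. Z i \<omega>) t"
  shows "prob {\<omega> \<in> space M. \<exists>n. c \<le> (\<Sum>t<n. u t (S t \<omega>, Z (Suc t) \<omega>))} \<le> exp (- c)"
proof -
  have Z' [measurable]: "Z t \<in> borel_measurable M" if "t \<ge> 1" for t
    using Z that by (simp add: indep_vars_def)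
  have S_meas: "S t \<in> borel_measurable M" for t
    unfolding S_def using F Z' by (rule measurable_driven)
  have uS [measurable]: "(\<lambda>\<omega>. u t (S t \<omega>, Z (Suc t) \<omega>)) \<in> borel_measurable M" for t
    by (rule borel_measurable_pair_comp[OF u S_meas]) (simp add: Z')
  \<comment> \<open>The real component accumulates \<open>u\<close> until it reaches
    \<open>c\<close> and is constant from then on.\<close>
  define F' where "F' t = (\<lambda>p. (F t (fst (fst p), snd p),
    if c \<le> snd (fst p) then snd (fst p) else snd (fst p) + u t (fst (fst p), snd p)))" for t
  have proj1 [measurable]: "(\<lambda>p :: ('s \<times> real) \<times> 'z. fst (fst p)) \<in> borel_measurable borel"
    and proj2 [measurable]: "(\<lambda>p :: ('s \<times> real) \<times> 'z. snd (fst p)) \<in> borel_measurable borel"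
    and proj3 [measurable]: "(snd :: ('s \<times> real) \<times> 'z \<Rightarrow> 'z) \<in> borel_measurable borel"
    by (intro borel_measurable_continuous_onI continuous_intros)+
  have u' [measurable]: "(\<lambda>p :: ('s \<times> real) \<times> 'z. u t (fst (fst p), snd p)) \<in> borel_measurable borel" for t
    by (rule borel_measurable_pair_comp[OF u]) measurable
  have r' [measurable]: "(\<lambda>p :: ('s \<times> real) \<times> 'z. if c \<le> snd (fst p) then snd (fst p)
      else snd (fst p) + u t (fst (fst p), snd p)) \<in> borel_measurable borel" for t
    by measurable
  have F'_meas: "F' t \<in> borel_measurable borel" for t
  proof -
    have "(\<lambda>p :: ('s \<times> real) \<times> 'z. F t (fst (fst p), snd p)) \<in> borel_measurable borel"
      by (rule borel_measurable_pair_comp[OF F]) measurable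
    then show ?thesis unfolding F'_def using r'[of t] by (simp add: borel_prod[symmetric])
  qed
  define T where "T t \<omega> = driven F' (s0, 0) (\<lambda>i. Z i \<omega>) t" for t \<omega>
  have T_meas: "T t \<in> borel_measurable M" for t
    unfolding T_def using F'_meas Z' by (rule measurable_driven)
  have sndT [measurable]: "(\<lambda>\<omega>. snd (T t \<omega>)) \<in> borel_measurable M" for t
    using T_meas[of t] measurable_snd by (simp add: borel_prod[symmetric])
  have fstT: "fst (T t \<omega>) = S t \<omega>" for t \<omega>
    unfolding S_def T_def by (induction t) (simp_all add: F'_def)
  have T_Suc: "snd (T (Suc t) \<omega>) = (if c \<le> snd (T t \<omega>) then snd (T t \<omega>)
      else snd (T t \<omega>) + u t (S t \<omega>, Z (Suc t) \<omega>))" for t \<omega>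
    unfolding fstT[symmetric] by (simp add: T_def F'_def)
  have exp_T: "(\<integral>\<^sup>+ \<omega>. ennreal (exp (snd (T t \<omega>))) \<partial>M) \<le> 1" for t
  proof (induction t)
    case 0
    show ?case by (simp add: T_def emeasure_space_1)
  next
    case (Suc t)
    define f where "f p = ennreal (exp (if c \<le> snd (fst p) then snd (fst p)
      else snd (fst p) + u t (fst (fst p), snd p)))" for p :: "('s \<times> real) \<times> 'z"
    have f: "f \<in> borel_measurable borel" unfolding f_def by measurable
    have "(\<integral>\<^sup>+ \<omega>. ennreal (exp (snd (T (Suc t) \<omega>))) \<partial>M) = (\<integral>\<^sup>+ \<omega>. f (T t \<omega>, Z (Suc t) \<omega>) \<partial>M)"
      by (simp only: T_Suc f_def fst_conv snd_conv fstT)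
    also have "\<dots> = (\<integral>\<^sup>+ \<omega>. (\<integral>\<^sup>+ \<omega>'. f (T t \<omega>, Z (Suc t) \<omega>') \<partial>M) \<partial>M)"
      unfolding T_def by (rule nn_integral_driven[OF F'_meas Z f])
    also have "\<dots> \<le> (\<integral>\<^sup>+ \<omega>. ennreal (exp (snd (T t \<omega>))) \<partial>M)"
    proof (rule nn_integral_mono)
      fix \<omega>
      show "(\<integral>\<^sup>+ \<omega>'. f (T t \<omega>, Z (Suc t) \<omega>') \<partial>M) \<le> ennreal (exp (snd (T t \<omega>)))"
      proof (cases "c \<le> snd (T t \<omega>)")
        case True
        then have "f (T t \<omega>, z) = ennreal (exp (snd (T t \<omega>)))" for z
          by (simp only: f_def fst_conv snd_conv if_True)
        then show ?thesis by (simp only: nn_integral_const emeasure_space_1 mult_1_right order_refl)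
      next
        case False
        have "(\<lambda>\<omega>'. u t (S t \<omega>, Z (Suc t) \<omega>')) \<in> borel_measurable M"
          by (rule borel_measurable_pair_comp[OF u]) auto
        then have u_meas: "(\<lambda>\<omega>'. ennreal (exp (u t (S t \<omega>, Z (Suc t) \<omega>')))) \<in> borel_measurable M"
          by measurable
        have "f (T t \<omega>, Z (Suc t) \<omega>')
            = ennreal (exp (snd (T t \<omega>))) * ennreal (exp (u t (S t \<omega>, Z (Suc t) \<omega>')))" for \<omega>'
          using False by (simp only: f_def fst_conv snd_conv if_False exp_add fstT) (simp add: ennreal_mult)
        then have "(\<integral>\<^sup>+ \<omega>'. f (T t \<omega>, Z (Suc t) \<omega>') \<partial>M)
            = ennreal (exp (snd (T t \<omega>))) * (\<integral>\<^sup>+ \<omega>'. ennreal (exp (u t (S t \<omega>, Z (Suc t) \<omega>'))) \<partial>M)"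
          by (simp add: nn_integral_cmult[OF u_meas])
        also have "\<dots> \<le> ennreal (exp (snd (T t \<omega>))) * 1"
          by (intro mult_left_mono moment) simp
        finally show ?thesis by simp
      qed
    qed
    finally show ?case using Suc by simp
  qed
  define E where "E n = {\<omega> \<in> space M. \<exists>m\<le>n. c \<le> (\<Sum>t<m. u t (S t \<omega>, Z (Suc t) \<omega>))}" for n
  have E_meas [measurable]: "E n \<in> sets M" for n unfolding E_def by measurable
  have E_sub: "E n \<subseteq> {\<omega> \<in> space M. c \<le> snd (T n \<omega>)}" for n
  proof -
    \<comment> \<open>Invariant: either the level has been reached, and then the stopped sum stays
      there, or the stopped sum is still the plain sum and no partial sum so far has reached
      \<open>c\<close>.\<close>
    have *: "c \<le> snd (T n \<omega>) \<or> (snd (T n \<omega>) = (\<Sum>t<n. u t (S t \<omega>, Z (Suc t) \<omega>))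
        \<and> (\<forall>m\<le>n. (\<Sum>t<m. u t (S t \<omega>, Z (Suc t) \<omega>)) < c))" for \<omega>
    proof (induction n)
      case 0
      show ?case by (auto simp: T_def)
    next
      case (Suc n)
      then show ?case by (auto simp: T_Suc le_Suc_eq)
    qed
    show ?thesis
    proof
      fix \<omega> assume "\<omega> \<in> E n"
      then obtain m where "\<omega> \<in> space M" "m \<le> n" "c \<le> (\<Sum>t<m. u t (S t \<omega>, Z (Suc t) \<omega>))"
        unfolding E_def by blast
      moreover from this have "\<not> (\<Sum>t<m. u t (S t \<omega>, Z (Suc t) \<omega>)) < c" by linarith
      ultimately show "\<omega> \<in> {\<omega> \<in> space M. c \<le> snd (T n \<omega>)}" using *[of \<omega>] by blast
    qed
  qed
  have bound: "prob (E n) \<le> exp (- c)" for n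
  proof -
    have "prob (E n) \<le> prob {\<omega> \<in> space M. c \<le> snd (T n \<omega>)}"
      by (intro finite_measure_mono E_sub) measurable
    moreover have "emeasure M {\<omega> \<in> space M. c \<le> snd (T n \<omega>)} \<le> ennreal (exp (- c))"
    proof -
      have "{\<omega> \<in> space M. c \<le> snd (T n \<omega>)}
          = {\<omega> \<in> space M. 1 \<le> ennreal (exp (- c)) * ennreal (exp (snd (T n \<omega>)))}"
        by (simp flip: ennreal_mult' exp_add)
      also have "emeasure M \<dots> \<le> ennreal (exp (- c)) * (\<integral>\<^sup>+ \<omega>. ennreal (exp (snd (T n \<omega>))) * indicator (space M) \<omega> \<partial>M)"
        by (rule nn_integral_Markov_inequality) measurable
      also have "(\<integral>\<^sup>+ \<omega>. ennreal (exp (snd (T n \<omega>))) * indicator (space M) \<omega> \<partial>M)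
          = (\<integral>\<^sup>+ \<omega>. ennreal (exp (snd (T n \<omega>))) \<partial>M)"
        by (rule nn_integral_cong) simp
      also have "ennreal (exp (- c)) * \<dots> \<le> ennreal (exp (- c)) * 1"
        by (rule mult_left_mono[OF exp_T]) simp
      finally show ?thesis by simp
    qed
    ultimately show ?thesis by (simp add: emeasure_eq_measure)
  qed
  have "(\<lambda>n. prob (E n)) \<longlonglongrightarrow> prob (\<Union>n. E n)"
    by (rule finite_Lim_measure_incseq) (auto simp: incseq_def E_def intro: order_trans)
  then have "prob (\<Union>n. E n) \<le> exp (- c)"
    by (rule LIMSEQ_le_const2) (use bound in auto)
  also have "(\<Union>n. E n) = {\<omega> \<in> space M. \<exists>n. c \<le> (\<Sum>t<n. u t (S t \<omega>, Z (Suc t) \<omega>))}"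
    unfolding E_def by auto
  finally show ?thesis .
qed

text \<open>The approximation by \<open>C + 1 / Suc k\<close> covers the degenerate case \<open>C = 0\<close>.\<close>

lemma deviation_driven:
  fixes F :: "nat \<Rightarrow> 's::second_countable_topology \<times> 'z::second_countable_topology \<Rightarrow> 's"
    and s0 :: 's
    and u :: "nat \<Rightarrow> 's \<times> 'z \<Rightarrow> real"
  assumes F: "\<And>t. F t \<in> borel_measurable borel" and Z: "indep_vars (\<lambda>_. borel) Z {1..}"
    and u: "\<And>t. u t \<in> borel_measurable borel"
    and C: "C \<ge> 0" and \<delta>: "0 < \<delta>"
    and moment: "\<And>l t s. l \<ge> 0 \<Longrightarrow> l * C \<le> 1 \<Longrightarrow>
      (\<integral>\<^sup>+ \<omega>. ennreal (exp (l * u t (s, Z (Suc t) \<omega>))) \<partial>M) \<le> 1"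
  defines "S \<equiv> \<lambda>t \<omega>. driven F s0 (\<lambda>i. Z i \<omega>) t"
  shows "prob {\<omega> \<in> space M. \<forall>n. (\<Sum>t<n. u t (S t \<omega>, Z (Suc t) \<omega>)) \<le> C * ln (1 / \<delta>)} \<ge> 1 - \<delta>"
\<comment> \<open>For \<delta> at least 1 the claimed lower bound is not positive. Otherwise the
  logarithm is positive, which makes the events \<open>E k\<close> decrease.\<close>
proof (cases "\<delta> < 1")
  case False
  then show ?thesis by (simp add: order_trans[OF _ measure_nonneg])
next
  case True
  have Z' [measurable]: "Z t \<in> borel_measurable M" if "t \<ge> 1" for t
    using Z that by (simp add: indep_vars_def)
  have S_meas: "S t \<in> borel_measurable M" for t
    unfolding S_def using F Z' by (rule measurable_driven)
  have uS [measurable]: "(\<lambda>\<omega>. u t (S t \<omega>, Z (Suc t) \<omega>)) \<in> borel_measurable M" for t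
    by (rule borel_measurable_pair_comp[OF u S_meas]) (simp add: Z')
  have L: "ln (1 / \<delta>) > 0" using True \<delta> by simp
  define C' where "C' k = C + 1 / real (Suc k)" for k
  have C': "C' k > 0" "C \<le> C' k" for k using C by (simp_all add: C'_def add_nonneg_pos)
  \<comment> \<open>The inequality is strict because \<open>E k\<close> is the complement of the
    crossing event in the maximal inequality; the limit in \<open>k\<close> makes it weak.\<close>
  define E where "E k = {\<omega> \<in> space M. \<forall>n. (\<Sum>t<n. u t (S t \<omega>, Z (Suc t) \<omega>)) < C' k * ln (1 / \<delta>)}" for k
  have E_meas [measurable]: "E k \<in> sets M" for k unfolding E_def by measurable
  have E_prob: "prob (E k) \<ge> 1 - \<delta>" for k
  proof -
    define v where "v t p = 1 / C' k * u t p" for t p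
    have "prob {\<omega> \<in> space M. \<exists>n. ln (1 / \<delta>) \<le> (\<Sum>t<n. v t (S t \<omega>, Z (Suc t) \<omega>))} \<le> exp (- ln (1 / \<delta>))"
      unfolding S_def
    proof (rule maximal_inequality_driven[OF F Z])
      show "v t \<in> borel_measurable borel" for t
        unfolding v_def using u[of t] by measurable
      show "(\<integral>\<^sup>+ \<omega>. ennreal (exp (v t (s, Z (Suc t) \<omega>))) \<partial>M) \<le> 1" for t s
        unfolding v_def using C'[of k] by (intro moment) auto
    qed
    also have "exp (- ln (1 / \<delta>)) = \<delta>" using \<delta> by (simp add: ln_div)
    also have "{\<omega> \<in> space M. \<exists>n. ln (1 / \<delta>) \<le> (\<Sum>t<n. v t (S t \<omega>, Z (Suc t) \<omega>))} = space M - E k"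
      using C'(1)[of k] unfolding E_def v_def
      by (auto simp: sum_divide_distrib[symmetric] le_divide_eq mult.commute simp flip: not_le)
    finally show ?thesis by (simp add: prob_compl)
  qed
  have dec: "decseq E"
  proof (rule decseq_SucI)
    fix k
    have "C' (Suc k) \<le> C' k" by (simp add: C'_def frac_le)
    then have "C' (Suc k) * ln (1 / \<delta>) \<le> C' k * ln (1 / \<delta>)"
      using L by (intro mult_right_mono) auto
    then show "E (Suc k) \<subseteq> E k" unfolding E_def by (auto intro: less_le_trans)
  qed
  have "(\<lambda>k. prob (E k)) \<longlonglongrightarrow> prob (\<Inter>k. E k)"
    by (rule finite_Lim_measure_decseq) (use dec in auto)
  then have "1 - \<delta> \<le> prob (\<Inter>k. E k)"
    by (rule LIMSEQ_le_const) (use E_prob in auto)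
  also have "\<dots> \<le> prob {\<omega> \<in> space M. \<forall>n. (\<Sum>t<n. u t (S t \<omega>, Z (Suc t) \<omega>)) \<le> C * ln (1 / \<delta>)}"
  proof (rule finite_measure_mono)
    show "(\<Inter>k. E k) \<subseteq> {\<omega> \<in> space M. \<forall>n. (\<Sum>t<n. u t (S t \<omega>, Z (Suc t) \<omega>)) \<le> C * ln (1 / \<delta>)}"
    proof (safe)
      fix \<omega> n assume \<omega>: "\<omega> \<in> (\<Inter>k. E k)"
      then show "\<omega> \<in> space M" by (auto simp: E_def)
      have "C' \<longlonglongrightarrow> C + 0"
        unfolding C'_def using LIMSEQ_Suc[OF lim_1_over_n[where 'a = real]] by (intro tendsto_intros) auto
      then have "(\<lambda>k. C' k * ln (1 / \<delta>)) \<longlonglongrightarrow> C * ln (1 / \<delta>)" by (intro tendsto_intros) auto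
      then show "(\<Sum>t<n. u t (S t \<omega>, Z (Suc t) \<omega>)) \<le> C * ln (1 / \<delta>)"
        by (rule LIMSEQ_le_const) (use \<omega> in \<open>auto simp: E_def intro: less_imp_le\<close>)
    qed
  qed measurable
  finally show ?thesis .
qed

end

section \<open>The filter as a driven recursion\<close>

lemma borel_measurable_matrix_vector_mult [measurable (raw)]:
  fixes f :: "'a \<Rightarrow> real ^ 'n ^ 'm"
  assumes "f \<in> borel_measurable M" "g \<in> borel_measurable M"
  shows "(\<lambda>x. f x *v g x) \<in> borel_measurable M"
  using assms by (rule borel_measurable_continuous_Pair)
    (simp add: matrix_vector_mult_def, intro continuous_intros)

lemma borel_measurable_matrix_matrix_mult [measurable (raw)]:
  fixes f :: "'a \<Rightarrow> real ^ 'n ^ 'm" and g :: "'a \<Rightarrow> real ^ 'k ^ 'n"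
  assumes "f \<in> borel_measurable M" "g \<in> borel_measurable M"
  shows "(\<lambda>x. f x ** g x) \<in> borel_measurable M"
  using assms by (rule borel_measurable_continuous_Pair)
    (simp add: matrix_matrix_mult_def, intro continuous_intros)

lemma borel_measurable_outer [measurable (raw)]:
  assumes "f \<in> borel_measurable M" "g \<in> borel_measurable M"
  shows "(\<lambda>x. outer (f x) (g x)) \<in> borel_measurable M"
  using assms by (rule borel_measurable_continuous_Pair)
    (simp add: outer_def, intro continuous_intros)

definition ekf_step :: "real \<Rightarrow> (real \<Rightarrow> real) \<Rightarrow>
    ((real ^ 'n ^ 'n) \<times> (real ^ 'n)) \<times> ((real ^ 'n) \<times> real) \<Rightarrow> (real ^ 'n ^ 'n) \<times> (real ^ 'n)" where
  "ekf_step a b p = (let P = fst (fst p); \<theta> = snd (fst p); x = fst (snd p); y = snd (snd p);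
     \<alpha> = deriv (deriv b) (\<theta> \<bullet> x) / a;
     P' = P - (\<alpha> / (1 + (x \<bullet> (P *v x)) * \<alpha>)) *\<^sub>R (P ** outer x x ** P)
   in (P', \<theta> + P' *v (((y - deriv b (\<theta> \<bullet> x)) / a) *\<^sub>R x)))"

lemma borel_measurable_ekf_step:
  fixes a :: real
  assumes [measurable]: "deriv b \<in> borel_measurable borel" "deriv (deriv b) \<in> borel_measurable borel"
  shows "(ekf_step a b :: ((real ^ 'n ^ 'n) \<times> (real ^ 'n)) \<times> ((real ^ 'n) \<times> real) \<Rightarrow> _) \<in> borel_measurable borel"
proof -
  have [measurable]:
    "(\<lambda>p :: ((real ^ 'n ^ 'n) \<times> (real ^ 'n)) \<times> ((real ^ 'n) \<times> real). fst (fst p)) \<in> borel_measurable borel"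
    "(\<lambda>p :: ((real ^ 'n ^ 'n) \<times> (real ^ 'n)) \<times> ((real ^ 'n) \<times> real). snd (fst p)) \<in> borel_measurable borel"
    "(\<lambda>p :: ((real ^ 'n ^ 'n) \<times> (real ^ 'n)) \<times> ((real ^ 'n) \<times> real). fst (snd p)) \<in> borel_measurable borel"
    "(\<lambda>p :: ((real ^ 'n ^ 'n) \<times> (real ^ 'n)) \<times> ((real ^ 'n) \<times> real). snd (snd p)) \<in> borel_measurable borel"
    by (intro borel_measurable_continuous_onI continuous_intros)+
  define \<alpha> where "\<alpha> p = deriv (deriv b) (snd (fst p) \<bullet> fst (snd p)) / a"
    for p :: "((real ^ 'n ^ 'n) \<times> (real ^ 'n)) \<times> ((real ^ 'n) \<times> real)"
  define r where "r p = (snd (snd p) - deriv b (snd (fst p) \<bullet> fst (snd p))) / a"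
    for p :: "((real ^ 'n ^ 'n) \<times> (real ^ 'n)) \<times> ((real ^ 'n) \<times> real)"
  define P' where "P' p = fst (fst p) - (\<alpha> p / (1 + (fst (snd p) \<bullet> (fst (fst p) *v fst (snd p))) * \<alpha> p))
      *\<^sub>R (fst (fst p) ** outer (fst (snd p)) (fst (snd p)) ** fst (fst p))"
    for p :: "((real ^ 'n ^ 'n) \<times> (real ^ 'n)) \<times> ((real ^ 'n) \<times> real)"
  have [measurable]: "\<alpha> \<in> borel_measurable borel" "r \<in> borel_measurable borel"
    unfolding \<alpha>_def r_def by measurable
  have P' [measurable]: "P' \<in> borel_measurable borel"
    unfolding P'_def by measurable
  have "(\<lambda>p. snd (fst p) + P' p *v (r p *\<^sub>R fst (snd p))) \<in> borel_measurable borel"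
    by measurable
  from measurable_Pair[OF P' this]
  have "(\<lambda>p. (P' p, snd (fst p) + P' p *v (r p *\<^sub>R fst (snd p)))) \<in> borel_measurable borel"
    by (simp only: borel_prod)
  moreover have "ekf_step a b = (\<lambda>p. (P' p, snd (fst p) + P' p *v (r p *\<^sub>R fst (snd p))))"
    by (simp only: fun_eq_iff ekf_step_def Let_def P'_def \<alpha>_def r_def simp_thms)
  ultimately show ?thesis by simp
qed

text \<open>The recursion counts from 0 and the filter from 1: after \<open>t\<close> steps the
  state is the one that meets observation \<open>Suc t\<close>.\<close>

lemma driven_ekf_step:
  assumes "static_ekf a b P1 \<theta>1 x y P \<theta>"
  shows "driven (\<lambda>_. ekf_step a b) (P1, \<theta>1) (\<lambda>t. (x t, y t)) t = (P (Suc t), \<theta> (Suc t))"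
proof (induction t)
  case 0
  show ?case using assms by (simp add: static_ekf_def)
next
  case (Suc t)
  have "Suc t \<ge> 1" by simp
  with assms have "(P (Suc (Suc t)), \<theta> (Suc (Suc t))) = ekf_step a b ((P (Suc t), \<theta> (Suc t)), (x (Suc t), y (Suc t)))"
    unfolding static_ekf_def ekf_step_def Let_def fst_conv snd_conv Suc_eq_plus1[symmetric] by metis
  then show ?case by (simp only: driven.simps Suc.IH)
qed

text \<open>Substituting \<open>u = A *v w\<close> in the Rayleigh characterization removes the
  inverse and leaves conditions that are continuous in \<open>A\<close>.\<close>

lemma lambda_max_matrix_inv_le_iff:
  fixes A :: "real ^ 'n ^ 'n"
  assumes A: "posdef A"
  shows "lambda_max (matrix_inv A) \<le> c \<longleftrightarrow> (\<forall>w. w \<bullet> (A *v w) \<le> c * (norm (A *v w))\<^sup>2)"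
proof -
  have sym: "transpose (matrix_inv A) = matrix_inv A"
    using posdef_matrix_inv(4)[OF A] by (simp add: posdef_def)
  have inv: "matrix_inv A *v (A *v w) = w" "A *v (matrix_inv A *v w) = w" for w
    by (simp_all add: matrix_vector_mul_assoc posdef_matrix_inv(2,3)[OF A])
  have "(\<forall>u. u \<bullet> (matrix_inv A *v u) \<le> c * (norm u)\<^sup>2)
      \<longleftrightarrow> (\<forall>w. (A *v w) \<bullet> (matrix_inv A *v (A *v w)) \<le> c * (norm (A *v w))\<^sup>2)"
    by (metis inv(2))
  then show ?thesis
    unfolding lambda_max_le_iff[OF sym] by (simp add: inv(1) inner_commute)
qed

text \<open>A sublevel set is the preimage of an intersection of closed sets, one for each
  \<open>w\<close>, and such an intersection is closed even though uncountable.\<close>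

lemma borel_measurable_lambda_max_matrix_inv:
  fixes A :: "'a \<Rightarrow> real ^ 'n ^ 'n"
  assumes A: "A \<in> borel_measurable M" and pd: "\<And>\<omega>. \<omega> \<in> space M \<Longrightarrow> posdef (A \<omega>)"
  shows "(\<lambda>\<omega>. lambda_max (matrix_inv (A \<omega>))) \<in> borel_measurable M"
  unfolding borel_measurable_iff_le
proof
  fix c
  have cont: "continuous_on UNIV (\<lambda>B :: real ^ 'n ^ 'n. B *v w)" for w
    unfolding matrix_vector_mult_def by (intro continuous_intros)
  have "closed {B :: real ^ 'n ^ 'n. \<forall>w. w \<bullet> (B *v w) \<le> c * (norm (B *v w))\<^sup>2}"
    by (intro closed_Collect_all closed_Collect_le continuous_intros cont)
  then have "{B :: real ^ 'n ^ 'n. \<forall>w. w \<bullet> (B *v w) \<le> c * (norm (B *v w))\<^sup>2} \<in> sets borel"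
    by (rule borel_closed)
  from measurable_sets[OF A this]
  have "A -` {B. \<forall>w. w \<bullet> (B *v w) \<le> c * (norm (B *v w))\<^sup>2} \<inter> space M \<in> sets M" .
  also have "A -` {B. \<forall>w. w \<bullet> (B *v w) \<le> c * (norm (B *v w))\<^sup>2} \<inter> space M
      = {\<omega> \<in> space M. lambda_max (matrix_inv (A \<omega>)) \<le> c}"
    using lambda_max_matrix_inv_le_iff[OF pd] by auto
  finally show "{\<omega> \<in> space M. lambda_max (matrix_inv (A \<omega>)) \<le> c} \<in> sets M" .
qed

section \<open>Assembly of the risk bound\<close>

theorem theorem1:
  fixes M :: "'w measure"
    and X :: "'w \<Rightarrow> real ^ 'n" and Y :: "'w \<Rightarrow> real"
    and Xs :: "nat \<Rightarrow> 'w \<Rightarrow> real ^ 'n" and Ys :: "nat \<Rightarrow> 'w \<Rightarrow> real"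
    and \<X> :: "(real ^ 'n) set" and \<Y> :: "real set"
    and a D :: real and h b :: "real \<Rightarrow> real"
    and P1 :: "real ^ 'n ^ 'n" and \<theta>1 \<theta>star :: "real ^ 'n"
    and P :: "nat \<Rightarrow> 'w \<Rightarrow> real ^ 'n ^ 'n" and \<theta> :: "nat \<Rightarrow> 'w \<Rightarrow> real ^ 'n"
    and \<kappa> H \<rho> :: "real \<Rightarrow> real" and \<tau> :: "real \<Rightarrow> real \<Rightarrow> nat"
    and \<epsilon> \<delta> :: real
  assumes "prob_space M"
    \<comment> \<open>the generalized linear model\<close>
    and "a > 0"
    and "\<And>y. y \<in> \<Y> \<Longrightarrow> h y > 0"
    and "\<And>u. b differentiable (at u)"
    and "\<And>u. deriv b differentiable (at u)"
    and "\<And>u. deriv (deriv b) u \<ge> 0"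
    and "\<And>\<phi>. integrable M (\<lambda>\<omega>. glm_loss a h b (Y \<omega>) (\<phi> \<bullet> X \<omega>))"
    \<comment> \<open>the static extended Kalman filter\<close>
    and "posdef P1"
    and "\<And>\<omega>. \<omega> \<in> space M \<Longrightarrow>
           static_ekf a b P1 \<theta>1 (\<lambda>t. Xs t \<omega>) (\<lambda>t. Ys t \<omega>) (\<lambda>t. P t \<omega>) (\<lambda>t. \<theta> t \<omega>)"
    \<comment> \<open>(i)\<close>
    and "X \<in> borel_measurable M" and "Y \<in> borel_measurable M"
    and "AE \<omega> in M. X \<omega> \<in> \<X> \<and> Y \<omega> \<in> \<Y>"
    and "prob_space.indep_vars M (\<lambda>_. borel) (\<lambda>t \<omega>. (Xs t \<omega>, Ys t \<omega>)) {1..}"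
    and "\<And>t. t \<ge> 1 \<Longrightarrow>
           distr M borel (\<lambda>\<omega>. (Xs t \<omega>, Ys t \<omega>)) = distr M borel (\<lambda>\<omega>. (X \<omega>, Y \<omega>))"
    and "posdef (LINT \<omega>|M. outer (X \<omega>) (X \<omega>))"
    and "\<And>x. x \<in> \<X> \<Longrightarrow> norm x \<le> D"
    \<comment> \<open>(ii)\<close>
    and "bdd_below (range (glm_risk M a h b X Y))"
    and "glm_risk M a h b X Y \<theta>star = (INF \<phi>. glm_risk M a h b X Y \<phi>)"
    \<comment> \<open>(iii)\<close>
    and "\<And>e. e > 0 \<Longrightarrow> \<kappa> e \<ge> 0"
    and "(\<rho> \<longlongrightarrow> 1) (at_right 0)"
    and "\<And>e \<phi> \<phi>'. \<lbrakk>e > 0; max (norm (\<phi> - \<theta>star)) (norm (\<phi>' - \<theta>star)) \<le> e\<rbrakk> \<Longrightarrow>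
           AE \<omega> in M.
             (glm_loss' a h b (Y \<omega>) (\<phi> \<bullet> X \<omega>))\<^sup>2 \<le> \<kappa> e * glm_loss'' a h b (Y \<omega>) (\<phi> \<bullet> X \<omega>) \<and>
             glm_loss'' a h b (Y \<omega>) (\<phi> \<bullet> X \<omega>) \<le> H e \<and>
             glm_loss'' a h b (Y \<omega>) (\<phi> \<bullet> X \<omega>) \<ge> \<rho> e * glm_loss'' a h b (Y \<omega>) (\<phi>' \<bullet> X \<omega>)"
    \<comment> \<open>(iv)\<close>
    and "\<And>d e. \<lbrakk>d > 0; e > 0\<rbrakk> \<Longrightarrow>
           measure M {\<omega> \<in> space M. \<forall>t > \<tau> e d. norm (\<theta> t \<omega> - \<theta>star) \<le> e} \<ge> 1 - d"
    and "\<epsilon> > 0" and "\<rho> \<epsilon> > 0.95" and "\<delta> > 0"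
  shows "measure M {\<omega> \<in> space M. \<forall>n\<ge>1.
           (\<Sum>t = \<tau> \<epsilon> \<delta> + 1..\<tau> \<epsilon> \<delta> + n.
              glm_risk M a h b X Y (\<theta> t \<omega>) - glm_risk M a h b X Y \<theta>star)
           \<le> 5 / 2 * real CARD('n) * \<kappa> \<epsilon>
                * ln (1 + real n * (H \<epsilon> * lambda_max P1 * D\<^sup>2 / real CARD('n)))
             + 5 * lambda_max (matrix_inv (P (\<tau> \<epsilon> \<delta> + 1) \<omega>)) * \<epsilon>\<^sup>2
             + 30 * (2 * \<kappa> \<epsilon> + H \<epsilon> * \<epsilon>\<^sup>2 * D\<^sup>2) * ln (1 / \<delta>)}
         \<ge> 1 - 3 * \<delta>"
proof -
  interpret prob_space M by fact
  note a = assms(2) and b = assms(4) and b' = assms(5) and b'' = assms(6) and ekf = assms(9)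
  note [measurable] = assms(10,11)
  have XY [measurable]: "(\<lambda>\<omega>. (X \<omega>, Y \<omega>)) \<in> borel_measurable M"
    using measurable_Pair[OF assms(10,11)] by (simp only: borel_prod)
  define \<mu> where "\<mu> = distr M borel (\<lambda>\<omega>. (X \<omega>, Y \<omega>))"
  have AE_\<mu>: "(AE z in \<mu>. A z) \<longleftrightarrow> (AE \<omega> in M. A (X \<omega>, Y \<omega>))"
    if "{z. A z} \<in> sets borel" for A
    unfolding \<mu>_def using that by (intro AE_distr_iff XY) simp
  have b_cont: "continuous_on UNIV b" and b'_cont: "continuous_on UNIV (deriv b)"
    using b b' by (simp_all add: continuous_at_imp_continuous_on differentiable_imp_continuous_within)
  have [measurable]: "b \<in> borel_measurable borel" "deriv b \<in> borel_measurable borel"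
    "deriv (deriv b) \<in> borel_measurable borel"
    using b_cont b'_cont borel_measurable_deriv[OF b'] by (auto intro: borel_measurable_continuous_onI)
  have [measurable]: "(fst :: (real ^ 'n) \<times> real \<Rightarrow> _) \<in> borel_measurable borel"
    "(snd :: (real ^ 'n) \<times> real \<Rightarrow> _) \<in> borel_measurable borel"
    by (intro borel_measurable_continuous_onI continuous_intros)+
  define loss where "loss \<phi> z = (b (\<phi> \<bullet> fst z) - snd z * (\<phi> \<bullet> fst z)) / a"
    for \<phi> and z :: "(real ^ 'n) \<times> real"
  have [measurable]: "loss \<phi> \<in> borel_measurable borel" for \<phi>
    unfolding loss_def by measurable
  define \<l> where "\<l> \<phi> \<omega> = glm_loss a h b (Y \<omega>) (\<phi> \<bullet> X \<omega>)" for \<phi> \<omega>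
  have int_\<l>: "integrable M (\<l> \<phi>)" for \<phi> unfolding \<l>_def by fact
  \<comment> \<open>Subtracting the loss at parameter 0 cancels \<open>ln (h (Y \<omega>))\<close>,
    as \<open>h\<close> is not assumed measurable. The constant \<open>b 0 / a\<close> restores the
    normalization of \<open>loss\<close>.\<close>
  have \<l>_eq: "AE \<omega> in M. \<l> \<phi> \<omega> - \<l> 0 \<omega> + b 0 / a = loss \<phi> (X \<omega>, Y \<omega>)" for \<phi>
    using assms(12)
  proof eventually_elim
    case (elim \<omega>)
    then have "h (Y \<omega>) > 0" using assms(3) by blast
    then show ?case unfolding \<l>_def loss_def by (simp add: glm_loss_eq diff_divide_distrib)
  qed
  have int_loss: "integrable \<mu> (loss \<phi>)" for \<phi>
  proof -
    have "integrable M (\<lambda>\<omega>. \<l> \<phi> \<omega> - \<l> 0 \<omega> + b 0 / a)" using int_\<l> by simp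
    moreover have "(\<lambda>\<omega>. loss \<phi> (X \<omega>, Y \<omega>)) \<in> borel_measurable M" by measurable
    ultimately have "integrable M (\<lambda>\<omega>. loss \<phi> (X \<omega>, Y \<omega>))"
      using \<l>_eq[of \<phi>] by (rule integrable_cong_AE_imp)
    then show ?thesis unfolding \<mu>_def by (subst integrable_distr_eq) auto
  qed
  define K where "K = (LINT \<omega>|M. \<l> 0 \<omega>) - b 0 / a"
  have risk_eq: "glm_risk M a h b X Y \<phi> = (LINT z|\<mu>. loss \<phi> z) + K" for \<phi>
  proof -
    have "(LINT z|\<mu>. loss \<phi> z) = (LINT \<omega>|M. loss \<phi> (X \<omega>, Y \<omega>))"
      unfolding \<mu>_def by (subst integral_distr) auto
    also have "\<dots> = (LINT \<omega>|M. \<l> \<phi> \<omega> - \<l> 0 \<omega> + b 0 / a)"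
      using int_\<l> \<l>_eq[of \<phi>] by (intro integral_cong_AE) (auto simp: borel_measurable_integrable)
    also have "\<dots> = (LINT \<omega>|M. \<l> \<phi> \<omega>) - (LINT \<omega>|M. \<l> 0 \<omega>) + b 0 / a"
      using int_\<l> by (simp add: prob_space)
    finally show ?thesis by (simp add: glm_risk_def K_def \<l>_def)
  qed
  have derivs: "AE \<omega> in M. \<forall>u. glm_loss' a h b (Y \<omega>) u = (deriv b u - Y \<omega>) / a \<and>
      glm_loss'' a h b (Y \<omega>) u = deriv (deriv b) u / a"
    using assms(12)
  proof eventually_elim
    case (elim \<omega>)
    then have "h (Y \<omega>) > 0" using assms(3) by blast
    then show ?case using glm_loss'_eq[of a h "Y \<omega>" b] glm_loss''_eq[of a h "Y \<omega>" b] a b b' by simp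
  qed
  have iii: "AE \<omega> in M. ((deriv b (\<phi> \<bullet> X \<omega>) - Y \<omega>) / a)\<^sup>2 \<le> \<kappa> \<epsilon> * (deriv (deriv b) (\<phi> \<bullet> X \<omega>) / a) \<and>
      deriv (deriv b) (\<phi> \<bullet> X \<omega>) / a \<le> H \<epsilon> \<and>
      \<rho> \<epsilon> * deriv (deriv b) (\<phi>' \<bullet> X \<omega>) \<le> deriv (deriv b) (\<phi> \<bullet> X \<omega>)"
    if "norm (\<phi> - \<theta>star) \<le> \<epsilon>" "norm (\<phi>' - \<theta>star) \<le> \<epsilon>" for \<phi> \<phi>'
  proof -
    have "max (norm (\<phi> - \<theta>star)) (norm (\<phi>' - \<theta>star)) \<le> \<epsilon>" using that by simp
    from assms(21)[OF assms(23) this] derivs show ?thesis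
    proof eventually_elim
      case (elim \<omega>)
      then show ?case using a by (simp add: divide_le_cancel)
    qed
  qed
  interpret G: local_glm \<mu> a b \<theta>star \<epsilon> "\<kappa> \<epsilon>" "H \<epsilon>" "\<rho> \<epsilon>" D
  proof (intro local_glm.intro local_glm_axioms.intro)
    show "prob_space \<mu>" unfolding \<mu>_def by (rule prob_space_distr[OF XY])
    show "sets \<mu> = sets borel" by (simp add: \<mu>_def)
    show "integrable \<mu> (\<lambda>z. (b (\<phi> \<bullet> fst z) - snd z * (\<phi> \<bullet> fst z)) / a)" for \<phi>
      using int_loss[of \<phi>] by (simp add: loss_def[abs_def])
    show "AE z in \<mu>. norm (fst z) \<le> D"
      using assms(12,16) by (subst AE_\<mu>) (auto elim!: eventually_mono)
    show "(LINT z|\<mu>. (b (\<theta>star \<bullet> fst z) - snd z * (\<theta>star \<bullet> fst z)) / a)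
        \<le> (LINT z|\<mu>. (b (\<phi> \<bullet> fst z) - snd z * (\<phi> \<bullet> fst z)) / a)" for \<phi>
    proof -
      have "glm_risk M a h b X Y \<theta>star \<le> glm_risk M a h b X Y \<phi>"
        unfolding assms(18) using assms(17) by (intro cINF_lower) auto
      then show ?thesis by (simp add: risk_eq loss_def[abs_def])
    qed
    show "AE z in \<mu>. ((deriv b (\<phi> \<bullet> fst z) - snd z) / a)\<^sup>2 \<le> \<kappa> \<epsilon> * (deriv (deriv b) (\<phi> \<bullet> fst z) / a)"
      if "norm (\<phi> - \<theta>star) \<le> \<epsilon>" for \<phi>
      using iii[OF that that] by (subst AE_\<mu>) (auto elim!: eventually_mono)
    show "AE z in \<mu>. deriv (deriv b) (\<phi> \<bullet> fst z) / a \<le> H \<epsilon>"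
      if "norm (\<phi> - \<theta>star) \<le> \<epsilon>" for \<phi>
      using iii[OF that that] by (subst AE_\<mu>) (auto elim!: eventually_mono)
    show "AE z in \<mu>. \<rho> \<epsilon> * deriv (deriv b) (\<phi>' \<bullet> fst z) \<le> deriv (deriv b) (\<phi> \<bullet> fst z)"
      if "norm (\<phi> - \<theta>star) \<le> \<epsilon>" "norm (\<phi>' - \<theta>star) \<le> \<epsilon>" for \<phi> \<phi>'
      using iii[OF that] by (subst AE_\<mu>) (auto elim!: eventually_mono)
  qed (fact a b b' b'' assms(19)[OF assms(23)] assms(23,24))+
  have risk_diff: "glm_risk M a h b X Y \<phi> - glm_risk M a h b X Y \<theta>star = G.risk \<phi> - G.risk \<theta>star" for \<phi>
    by (simp add: risk_eq G.risk_def G.loss_def loss_def)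

  define Z where "Z t \<omega> = (Xs t \<omega>, Ys t \<omega>)" for t \<omega>
  have Z: "indep_vars (\<lambda>_. borel) Z {1..}" using assms(13) by (simp add: Z_def[abs_def])
  then have Z_meas [measurable]: "Z (Suc t) \<in> borel_measurable M" for t by (simp add: indep_vars_def)
  have distr_Z: "distr M borel (Z (Suc t)) = \<mu>" for t
    using assms(14)[of "Suc t"] by (simp add: Z_def[abs_def] \<mu>_def)
  have F: "ekf_step a b \<in> borel_measurable borel" by (rule borel_measurable_ekf_step) measurable
  define S where "S t \<omega> = driven (\<lambda>_. ekf_step a b) (P1, \<theta>1) (\<lambda>i. Z i \<omega>) t" for t \<omega>
  have S_meas: "S t \<in> borel_measurable M" for t
    unfolding S_def by (rule measurable_driven[OF F]) (use Z in \<open>simp add: indep_vars_def\<close>)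
  have S_eq: "S t \<omega> = (P (Suc t) \<omega>, \<theta> (Suc t) \<omega>)" if "\<omega> \<in> space M" for t \<omega>
    unfolding S_def Z_def by (rule driven_ekf_step[OF ekf[OF that]])
  have [measurable]: "(fst :: (real ^ 'n ^ 'n) \<times> (real ^ 'n) \<Rightarrow> _) \<in> borel_measurable borel"
    "(snd :: (real ^ 'n ^ 'n) \<times> (real ^ 'n) \<Rightarrow> _) \<in> borel_measurable borel"
    by (intro borel_measurable_continuous_onI continuous_intros)+
  have P_meas: "P (Suc t) \<in> borel_measurable M" and \<theta>_meas [measurable]: "\<theta> (Suc t) \<in> borel_measurable M" for t
  proof -
    have "(\<lambda>\<omega>. fst (S t \<omega>)) \<in> borel_measurable M" "(\<lambda>\<omega>. snd (S t \<omega>)) \<in> borel_measurable M"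
      using S_meas[of t] by measurable
    then show "P (Suc t) \<in> borel_measurable M" "\<theta> (Suc t) \<in> borel_measurable M"
      by (simp_all add: S_eq cong: measurable_cong)
  qed
  have pd: "posdef (P (Suc t) \<omega>)" if "\<omega> \<in> space M" for t \<omega>
    by (rule static_ekf_covariance[OF ekf[OF that] assms(8) a b'']) simp

  define T where "T = \<tau> \<epsilon> \<delta>"
  have shift: "(\<Sum>t = T + 1..T + n. f t) = (\<Sum>t\<in>{T..<T+n}. f (Suc t))" for f :: "nat \<Rightarrow> real" and n
    using sum.shift_bounds_Suc_ivl[of f T "T + n"]
    by (simp only: atLeastLessThanSuc_atLeastAtMost flip: Suc_eq_plus1)
  define q where "q = H \<epsilon> * \<epsilon>\<^sup>2 * D\<^sup>2"
  define C where "C = 6 * (2 * \<kappa> \<epsilon> + q)"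
  have C: "C \<ge> 0" using G.H_nonneg G.\<kappa>_nonneg by (simp add: C_def q_def)
  define w where "w \<phi> z = (G.risk \<phi> - G.risk \<theta>star) / 5 - G.grad \<phi> (\<phi> - \<theta>star) z + G.hess \<phi> (\<phi> - \<theta>star) z / 2"
    for \<phi> z
  define u where "u t p = (if T \<le> t \<and> norm (snd (fst p) - \<theta>star) \<le> \<epsilon> then w (snd (fst p)) (snd p) else 0)"
    for t :: nat and p :: "((real ^ 'n ^ 'n) \<times> (real ^ 'n)) \<times> ((real ^ 'n) \<times> real)"
  define E1 where "E1 = {\<omega> \<in> space M. \<forall>t > T. norm (\<theta> t \<omega> - \<theta>star) \<le> \<epsilon>}"
  define E2 where "E2 = {\<omega> \<in> space M. \<forall>n. (\<Sum>t<n. u t (S t \<omega>, Z (Suc t) \<omega>)) \<le> C * ln (1 / \<delta>)}"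
  define bound where "bound n \<omega> = 5 / 2 * real CARD('n) * \<kappa> \<epsilon>
                * ln (1 + real n * (H \<epsilon> * lambda_max P1 * D\<^sup>2 / real CARD('n)))
             + 5 * lambda_max (matrix_inv (P (T + 1) \<omega>)) * \<epsilon>\<^sup>2
             + 30 * (2 * \<kappa> \<epsilon> + H \<epsilon> * \<epsilon>\<^sup>2 * D\<^sup>2) * ln (1 / \<delta>)" for n :: nat and \<omega>
  define E where "E = {\<omega> \<in> space M. \<forall>n\<ge>1. (\<Sum>t = T + 1..T + n.
              glm_risk M a h b X Y (\<theta> t \<omega>) - glm_risk M a h b X Y \<theta>star) \<le> bound n \<omega>}"

  have u_meas: "u t \<in> borel_measurable borel" for t
  proof -
    have proj [measurable]:
      "(\<lambda>p :: ((real ^ 'n ^ 'n) \<times> (real ^ 'n)) \<times> ((real ^ 'n) \<times> real). snd (fst p)) \<in> borel_measurable borel"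
      "(snd :: ((real ^ 'n ^ 'n) \<times> (real ^ 'n)) \<times> ((real ^ 'n) \<times> real) \<Rightarrow> _) \<in> borel_measurable borel"
      by (intro borel_measurable_continuous_onI continuous_intros)+
    note [measurable] = G.borel_risk borel_measurable_pair_comp[OF G.borel_grad proj, simplified]
      borel_measurable_pair_comp[OF G.borel_hess proj, simplified]
    show ?thesis unfolding u_def w_def by measurable
  qed
  have E2: "prob E2 \<ge> 1 - \<delta>"
    unfolding E2_def S_def
  proof (rule deviation_driven[OF F Z u_meas C \<open>\<delta> > 0\<close>])
    fix l :: real and t s
    assume l: "l \<ge> 0" "l * C \<le> 1"
    have "(\<lambda>z. ennreal (exp (l * u t (s, z)))) \<in> borel_measurable borel"
      using borel_measurable_pair_comp[OF u_meas, of "\<lambda>_. s" borel "\<lambda>z. z" t] by measurable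
    then have "(\<integral>\<^sup>+ \<omega>. ennreal (exp (l * u t (s, Z (Suc t) \<omega>))) \<partial>M) = (\<integral>\<^sup>+ z. ennreal (exp (l * u t (s, z))) \<partial>\<mu>)"
      unfolding distr_Z[of t, symmetric] by (subst nn_integral_distr) auto
    also have "\<dots> \<le> 1"
    proof (cases "T \<le> t \<and> norm (snd s - \<theta>star) \<le> \<epsilon>")
      case True
      have "l * (6 * (2 * \<kappa> \<epsilon> + H \<epsilon> * \<epsilon>\<^sup>2 * D\<^sup>2)) \<le> 1" using l by (simp add: C_def q_def)
      with True show ?thesis using G.exponential_moment[of "snd s" l] l by (simp add: u_def w_def)
    next
      case False
      then have "u t (s, z) = 0" for z by (auto simp: u_def)
      then show ?thesis by (simp add: G.emeasure_space_1)
    qed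
    finally show "(\<integral>\<^sup>+ \<omega>. ennreal (exp (l * u t (s, Z (Suc t) \<omega>))) \<partial>M) \<le> 1" .
  qed
  have E1: "prob E1 \<ge> 1 - \<delta>" unfolding E1_def T_def using assms(22,23,25) by blast
  have E1_sets: "E1 \<in> events"
  proof -
    \<comment> \<open>Index 0 of the filter is unconstrained, so measurability is available only for
      \<open>\<theta> (Suc t)\<close>.\<close>
    have "E1 = {\<omega> \<in> space M. \<forall>t \<ge> T. norm (\<theta> (Suc t) \<omega> - \<theta>star) \<le> \<epsilon>}"
      unfolding E1_def by (auto simp: less_eq_Suc_le) (metis Suc_le_D Suc_le_mono)
    then show ?thesis by simp
  qed
  have E2_sets: "E2 \<in> events"
  proof -
    have [measurable]: "(\<lambda>\<omega>. u t (S t \<omega>, Z (Suc t) \<omega>)) \<in> borel_measurable M" for t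
      by (rule borel_measurable_pair_comp[OF u_meas S_meas Z_meas])
    show ?thesis unfolding E2_def by measurable
  qed
  \<comment> \<open>\<open>measure\<close> is zero outside the sigma-algebra by convention, so
    measurability of this event is part of the claim.\<close>
  have E_sets: "E \<in> events"
  proof -
    have [measurable]: "(\<lambda>\<omega>. lambda_max (matrix_inv (P (Suc T) \<omega>))) \<in> borel_measurable M"
      by (rule borel_measurable_lambda_max_matrix_inv[OF P_meas pd])
    have [measurable]: "(\<lambda>\<omega>. bound n \<omega>) \<in> borel_measurable M" for n
      unfolding bound_def by simp
    have "E = {\<omega> \<in> space M. \<forall>n\<ge>1. (\<Sum>t\<in>{T..<T+n}. G.risk (\<theta> (Suc t) \<omega>) - G.risk \<theta>star) \<le> bound n \<omega>}"
      unfolding E_def risk_diff shift ..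
    then show ?thesis using G.borel_risk by simp
  qed

  \<comment> \<open>The bounds at the random parameters, one null set per time, are collected into a
    single null set; being in the ball is a premise, so no conditioning occurs.\<close>
  have "AE \<omega> in M. \<forall>t. norm (Xs (Suc t) \<omega>) \<le> D \<and> (norm (\<theta> (Suc t) \<omega> - \<theta>star) \<le> \<epsilon> \<longrightarrow>
      ((deriv b (\<theta> (Suc t) \<omega> \<bullet> Xs (Suc t) \<omega>) - Ys (Suc t) \<omega>) / a)\<^sup>2
        \<le> \<kappa> \<epsilon> * (deriv (deriv b) (\<theta> (Suc t) \<omega> \<bullet> Xs (Suc t) \<omega>) / a) \<and>
      deriv (deriv b) (\<theta> (Suc t) \<omega> \<bullet> Xs (Suc t) \<omega>) / a \<le> H \<epsilon>)"
    (is "AE \<omega> in M. \<forall>t. ?good t \<omega>")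
  proof (subst AE_all_countable, rule allI)
    fix t
    define A where "A = {p :: ((real ^ 'n ^ 'n) \<times> (real ^ 'n)) \<times> ((real ^ 'n) \<times> real).
      norm (fst (snd p)) \<le> D \<and> (norm (snd (fst p) - \<theta>star) \<le> \<epsilon> \<longrightarrow>
      ((deriv b (snd (fst p) \<bullet> fst (snd p)) - snd (snd p)) / a)\<^sup>2
        \<le> \<kappa> \<epsilon> * (deriv (deriv b) (snd (fst p) \<bullet> fst (snd p)) / a) \<and>
      deriv (deriv b) (snd (fst p) \<bullet> fst (snd p)) / a \<le> H \<epsilon>)}"
    have [measurable]:
      "(\<lambda>p :: ((real ^ 'n ^ 'n) \<times> (real ^ 'n)) \<times> ((real ^ 'n) \<times> real). snd (fst p)) \<in> borel_measurable borel"
      "(\<lambda>p :: ((real ^ 'n ^ 'n) \<times> (real ^ 'n)) \<times> ((real ^ 'n) \<times> real). fst (snd p)) \<in> borel_measurable borel"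
      "(\<lambda>p :: ((real ^ 'n ^ 'n) \<times> (real ^ 'n)) \<times> ((real ^ 'n) \<times> real). snd (snd p)) \<in> borel_measurable borel"
      by (intro borel_measurable_continuous_onI continuous_intros)+
    have A: "A \<in> sets borel" unfolding A_def by measurable
    have "AE \<omega> in M. (S t \<omega>, Z (Suc t) \<omega>) \<in> A"
      unfolding S_def
    proof (rule AE_driven[OF F Z A])
      fix s :: "(real ^ 'n ^ 'n) \<times> (real ^ 'n)"
      have "AE z in \<mu>. (s, z) \<in> A"
      proof (cases "norm (snd s - \<theta>star) \<le> \<epsilon>")
        case True
        from G.bounded G.gradient_bound[OF True] G.hessian_bound[OF True] show ?thesis
          by eventually_elim (simp add: A_def)
      next
        case False
        from G.bounded show ?thesis by eventually_elim (use False in \<open>simp add: A_def\<close>)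
      qed
      then show "AE \<omega> in M. (s, Z (Suc t) \<omega>) \<in> A"
        unfolding distr_Z[of t, symmetric] by (rule AE_distrD[OF Z_meas])
    qed
    then show "AE \<omega> in M. ?good t \<omega>"
      using AE_space by eventually_elim (simp add: A_def S_eq Z_def)
  qed
  then have "AE \<omega> in M. \<omega> \<in> E1 \<inter> E2 \<longrightarrow> \<omega> \<in> E"
    using AE_space
  proof eventually_elim
    case (elim \<omega>)
    show ?case
    proof
      assume \<omega>: "\<omega> \<in> E1 \<inter> E2"
      have close: "norm (\<theta> (Suc t) \<omega> - \<theta>star) \<le> \<epsilon>" if "T \<le> t" for t
        using \<omega> that by (auto simp: E1_def)
      have "(\<Sum>t = T + 1..T + n. glm_risk M a h b X Y (\<theta> t \<omega>) - glm_risk M a h b X Y \<theta>star) \<le> bound n \<omega>" for n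
      proof -
        define r where "r t = (deriv b (\<theta> t \<omega> \<bullet> Xs t \<omega>) - Ys t \<omega>) / a * ((\<theta> t \<omega> - \<theta>star) \<bullet> Xs t \<omega>)
            - deriv (deriv b) (\<theta> t \<omega> \<bullet> Xs t \<omega>) / a * ((\<theta> t \<omega> - \<theta>star) \<bullet> Xs t \<omega>)\<^sup>2 / 2" for t
        define V where "V = lambda_max (matrix_inv (P (Suc T) \<omega>)) * \<epsilon>\<^sup>2"
        define B where "B = CARD('n) * \<kappa> \<epsilon> * ln (1 + n * (H \<epsilon> * lambda_max P1 * D\<^sup>2 / CARD('n)))"
        have "(\<Sum>t\<in>{Suc T..<Suc T+n}. r t)
          \<le> V / 2 + B / 2"
          unfolding r_def V_def B_def
        proof (rule static_ekf_regret[OF ekf[OF elim(2)] assms(8) a b''])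
          fix t assume "Suc T \<le> t"
          then obtain s where s: "t = Suc s" "T \<le> s" using Suc_le_D by blast
          show "norm (Xs t \<omega>) \<le> D" "deriv (deriv b) (\<theta> t \<omega> \<bullet> Xs t \<omega>) / a \<le> H \<epsilon>"
            "((deriv b (\<theta> t \<omega> \<bullet> Xs t \<omega>) - Ys t \<omega>) / a)\<^sup>2 \<le> \<kappa> \<epsilon> * (deriv (deriv b) (\<theta> t \<omega> \<bullet> Xs t \<omega>) / a)"
            using elim(1) close[OF s(2)] unfolding s(1) by blast+
        qed (use close[of T] G.\<kappa>_nonneg in auto)
        also have "(\<Sum>t\<in>{Suc T..<Suc T+n}. r t) = (\<Sum>t\<in>{T..<T+n}. r (Suc t))"
          using sum.shift_bounds_Suc_ivl[of r T "T + n"] by (simp only: add_Suc)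
        finally have "(\<Sum>t\<in>{T..<T+n}. r (Suc t)) \<le> V / 2 + B / 2" .
        moreover have "(\<Sum>t<T+n. u t (S t \<omega>, Z (Suc t) \<omega>)) \<le> C * ln (1 / \<delta>)"
          using \<omega> by (auto simp: E2_def)
        moreover have "(\<Sum>t<T+n. u t (S t \<omega>, Z (Suc t) \<omega>)) =
            (\<Sum>t\<in>{T..<T+n}. (G.risk (\<theta> (Suc t) \<omega>) - G.risk \<theta>star) / 5 - r (Suc t))"
        proof -
          have "(\<Sum>t<T+n. u t (S t \<omega>, Z (Suc t) \<omega>)) = (\<Sum>t\<in>{T..<T+n}. u t (S t \<omega>, Z (Suc t) \<omega>))"
            by (intro sum.mono_neutral_right) (auto simp: u_def)
          also have "\<dots> = (\<Sum>t\<in>{T..<T+n}. (G.risk (\<theta> (Suc t) \<omega>) - G.risk \<theta>star) / 5 - r (Suc t))"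
          proof (rule sum.cong[OF refl])
            fix t assume "t \<in> {T..<T+n}"
            then show "u t (S t \<omega>, Z (Suc t) \<omega>) = (G.risk (\<theta> (Suc t) \<omega>) - G.risk \<theta>star) / 5 - r (Suc t)"
              using close[of t] by (simp add: u_def w_def S_eq[OF elim(2)] Z_def G.grad_def G.hess_def r_def)
          qed
          finally show ?thesis .
        qed
        moreover have "(\<Sum>t = T + 1..T + n. glm_risk M a h b X Y (\<theta> t \<omega>) - glm_risk M a h b X Y \<theta>star)
            = (\<Sum>t\<in>{T..<T+n}. G.risk (\<theta> (Suc t) \<omega>) - G.risk \<theta>star)"
          unfolding risk_diff by (rule shift)
        \<comment> \<open>The regret bound gives \<open>5 / 2 * V\<close>; nonnegativity of
          \<open>V\<close> allows the coefficient 5 of the claim.\<close>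
        moreover have "0 \<le> V"
        proof -
          have "posdef (matrix_inv (P (Suc T) \<omega>))" using pd[OF elim(2)] by (rule posdef_matrix_inv)
          then show ?thesis
            unfolding V_def using posdef_eigenval_pos lambda_max_rayleigh(1) by (metis less_imp_le mult_nonneg_nonneg posdef_def zero_le_power2)
        qed
        moreover have "bound n \<omega> = 5 / 2 * B + 5 * V + 5 * (C * ln (1 / \<delta>))"
          unfolding bound_def V_def B_def C_def q_def by (simp add: algebra_simps)
        ultimately show ?thesis
          unfolding sum_subtractf[of _ "\<lambda>t. r (Suc t)"] sum_divide_distrib[symmetric] by linarith
      qed
      then show "\<omega> \<in> E" using elim(2) by (simp add: E_def)
    qed
  qed
  then have "prob (E1 \<inter> E2) \<le> prob E"
    using E_sets by (intro finite_measure_mono_AE)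
  moreover have "prob (E1 \<union> E2) \<le> 1" by (rule prob_le_1)
  then have "prob (E1 \<inter> E2) \<ge> prob E1 + prob E2 - 1"
    using finite_measure_Union'[OF E1_sets E2_sets] finite_measure_Diff'[OF E2_sets E1_sets]
    by (simp add: Int_commute)
  \<comment> \<open>Two events, each failing with probability at most \<delta>, give
    \<open>1 - 2 * \<delta>\<close>, which is above the claimed value.\<close>
  ultimately have "prob E \<ge> 1 - 3 * \<delta>" using E1 E2 assms(25) by linarith
  then show ?thesis unfolding E_def bound_def T_def .
qed

end
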